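(* Let $d>1$ and $Q>0$ be real constants, let $q_1,q_2,\dots$ be positive real numbers with $q_j=Qj^{d-1}(1+o(1))$ as $j\to\infty$, and let $\chi:[0,\infty)\to(0,\infty)$ be a function with $\chi(x)\to\infty$ as $x\to\infty$ (arbitrarily slowly). Then there exist constants $C_s>0$, $s=1,2,\dots$, such that for every positive integer $M$ and every sequence $\{f_j\}_{j=1}^\infty$ of complex numbers with $\sup_j|f_j|\le 1$, $$\mathsf{P}_M\biggl(\biggl|\sum_{j=1}^\infty f_j(N_j-\overline{N}_j)\biggr|>\Delta\biggr)\le C_s\overline{N}^{-s},\qquad s=1,2,\dots,$$ where $\overline{N}_j$, $\overline{N}$ and $\Delta$ (which depend on $M$) and the probability measure $\mathsf{P}_M$ are as defined in the context.
   Context: For an integer $M\ge0$, $\Omega_M$ is the (finite) set of all sequences $\{N_j\}_{j=1}^\infty$ of nonnegative integers with $\sum_{j=1}^\infty jN_j\le M$. Each sequence has weight $w(\{N_j\})=\prod_{j=1}^\infty\binom{N_j+q_j-1}{N_j}$, where $\binom zn=\prod_{i=0}^{n-1}\frac{z-i}{n-i}$ is the generalized binomial coefficient (equal to $1$ for $n=0$). For $\mathcal{A}\subset\Omega_M$ put $w(\mathcal{A})=\sum_{\{N_j\}\in\mathcal{A}}w(\{N_j\})$ and $\mathsf{P}_M(\mathcal{A})=w(\mathcal{A})/w(\Omega_M)$; a condition inside $\mathsf{P}_M(\cdot)$ denotes the set of sequences in $\Omega_M$ satisfying it. For $M>0$, $b=b(M)>0$ is the unique solution of $\sum_{j=1}^\infty\frac{jq_j}{e^{bj}-1}=M$;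 $\overline{N}_j=\frac{q_j}{e^{bj}-1}$ for $j\ge1$; $\overline{N}=\sum_{j=1}^\infty\overline{N}_j$; and $\Delta=(\overline{N}\ln\overline{N})^{1/2}\chi(\overline{N})$ if $d>2$, $\Delta=\overline{N}^{1/d}\ln\overline{N}\,\chi(\overline{N})$ if $1<d\le2$. Convention: for the finitely many $M$ with $\overline{N}(M)<1$, when $d>2$, $(\overline{N}\ln\overline{N})^{1/2}$ is read as $0$. *)

theory Defs
  imports
    "HOL-Analysis.Analysis"
    "HOL-Library.Landau_Symbols"
begin

text \<open>
  Sequences indexed by \<open>j = 1, 2, \<dots>\<close> are functions on \<^typ>\<open>nat\<close> of which only the values at
  \<open>j \<ge> 1\<close> are meaningful. So that every \<open>{N\<^sub>j}\<close> has exactly one representative, the value at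
  \<open>0\<close> is fixed to be \<open>0\<close>. A series of nonnegative integers with a finite sum has finitely many
  nonzero terms, so \<open>\<Sum>\<^sub>j j N\<^sub>j \<le> M\<close> is finiteness of the support together with a bound on the
  finite sum.
\<close>

definition Omega :: "nat \<Rightarrow> (nat \<Rightarrow> nat) set" where
  "Omega M = {N. N 0 = 0 \<and> finite {j. N j \<noteq> 0} \<and> (\<Sum>j\<in>{j. N j \<noteq> 0}. j * N j) \<le> M}"

lemma finite_Omega: "finite (Omega M)"
proof (rule finite_subset)
  show "Omega M \<subseteq> {N. \<forall>j. (j \<in> {..M} \<longrightarrow> N j \<in> {..M}) \<and> (j \<notin> {..M} \<longrightarrow> N j = 0)}"
  proof
    fix N assume N: "N \<in> Omega M"
    have bound: "j * N j \<le> M" if "N j \<noteq> 0" for j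
    proof -
      have "j * N j \<le> (\<Sum>j\<in>{j. N j \<noteq> 0}. j * N j)"
        using N that by (intro member_le_sum) (auto simp: Omega_def)
      with N show ?thesis by (simp add: Omega_def)
    qed
    have "j \<le> M \<and> N j \<le> M" if "N j \<noteq> 0" for j
    proof -
      have "j \<noteq> 0" using N that by (auto simp: Omega_def intro: ccontr)
      then have "j \<le> j * N j" "N j \<le> j * N j" using that by auto
      with bound[OF that] show ?thesis by linarith
    qed
    then show "N \<in> {N. \<forall>j. (j \<in> {..M} \<longrightarrow> N j \<in> {..M}) \<and> (j \<notin> {..M} \<longrightarrow> N j = 0)}"
      by force
  qed
  show "finite {N. \<forall>j. (j \<in> {..M} \<longrightarrow> N j \<in> {..M}) \<and> (j \<notin> {..M} \<longrightarrow> N j = (0::nat))}"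
    by (rule finite_set_of_finite_funs) auto
qed

text \<open>
  The factors with \<open>N\<^sub>j = 0\<close> equal \<open>1\<close>, so the infinite product reduces to the product over the
  support. The form of the binomial coefficient as a product of quotients is
  \<open>gbinomial_altdef_of_nat\<close>.
\<close>

definition weight :: "(nat \<Rightarrow> real) \<Rightarrow> (nat \<Rightarrow> nat) \<Rightarrow> real" where
  "weight q N = (\<Prod>j\<in>{j. N j \<noteq> 0}. (real (N j) + q j - 1) gchoose N j)"

definition total_weight :: "(nat \<Rightarrow> real) \<Rightarrow> (nat \<Rightarrow> nat) set \<Rightarrow> real" where
  "total_weight q A = (\<Sum>N\<in>A. weight q N)"

definition Pr :: "(nat \<Rightarrow> real) \<Rightarrow> nat \<Rightarrow> (nat \<Rightarrow> nat) set \<Rightarrow> real" where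
  "Pr q M A = total_weight q A / total_weight q (Omega M)"

definition b_sol :: "(nat \<Rightarrow> real) \<Rightarrow> nat \<Rightarrow> real" where
  "b_sol q M = (THE \<beta>. \<beta> > 0 \<and>
     ((\<lambda>j. real j * q j / (exp (\<beta> * real j) - 1)) has_sum real M) {1..})"

definition Nbar_at :: "(nat \<Rightarrow> real) \<Rightarrow> nat \<Rightarrow> nat \<Rightarrow> real" where
  "Nbar_at q M j = q j / (exp (b_sol q M * real j) - 1)"

definition Nbar :: "(nat \<Rightarrow> real) \<Rightarrow> nat \<Rightarrow> real" where
  "Nbar q M = (\<Sum>\<^sub>\<infinity>j\<in>{1..}. Nbar_at q M j)"

text \<open>
  For \<open>d > 2\<close> and \<open>Nbar q M < 1\<close> the radicand is negative; the square root is then read as \<open>0\<close>.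
\<close>

definition Delta :: "real \<Rightarrow> (nat \<Rightarrow> real) \<Rightarrow> (real \<Rightarrow> real) \<Rightarrow> nat \<Rightarrow> real" where
  "Delta d q chi M =
     (if d > 2 then (if Nbar q M < 1 then 0 else sqrt (Nbar q M * ln (Nbar q M))) * chi (Nbar q M)
      else Nbar q M powr (1 / d) * ln (Nbar q M) * chi (Nbar q M))"

end

theory Submission
  imports Defs
begin

text \<open>
  Let \<open>W(M)\<close> be the total weight of \<^term>\<open>Omega M\<close>, \<open>F(\<beta>) = -\<Sum>\<^sub>j q\<^sub>j ln (1 - exp (-\<beta>j))\<close> and
  \<open>G(M) = min\<^sub>\<beta> (F(\<beta>) + \<beta>M)\<close>, attained at \<open>\<beta> = b(M)\<close>. A Chernoff bound with exponential
  weights shows that the event has weight at most \<open>exp(G(M))\<close> times any negative power of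
  \<open>Nbar\<close>, the tilting parameter being \<open>sqrt (ln Nbar / Nbar)\<close> for \<open>d > 2\<close> and \<open>b / 2\<close> for
  \<open>d \<le> 2\<close>. It remains to see that \<open>W(M)\<close> is at least \<open>exp(G(M))\<close> up to a power of \<open>M\<close>, and for
  this no local limit theorem is needed. With \<open>a\<^sub>k = \<Sum>\<^bsub>j dvd k\<^esub> j q\<^sub>j\<close>, which is of order
  \<open>k powr d\<close> because \<open>d > 1\<close>, one has \<open>M W(M) \<ge> \<Sum>\<^sub>k a\<^sub>k W(M - k)\<close> and \<open>\<Sum>\<^sub>k a\<^sub>k exp (-b(M)k) = M\<close>.
  Concavity of \<open>G\<close> costs only \<open>G(M - k) \<ge> G(M) - b k - C k\<^sup>2 b powr (d + 2)\<close>. In the weighted mean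
  over \<open>k\<close> the quadratic loss is of order \<open>b powr d\<close>, as is the gain \<open>A k / M\<close> from a factor
  \<open>M powr (-A)\<close>. So \<open>W(M) \<ge> c M powr (-A) exp(G(M))\<close> follows by induction for large \<open>A\<close>.
\<close>

section \<open>The weight recurrence\<close>

text \<open>The obstacle is the denominator of \<open>Pr\<close>: it must be known to within a power
  of \<open>M\<close>, while \<open>q\<close> is known only to leading order, too little for a
  saddle-point expansion. The recurrence fills this place. For \<open>q = 1\<close> and energy
  exactly \<open>M\<close> it is Euler's identity \<open>M p(M) = \<Sum>k sigma(k) p(M - k)\<close>
  for partition numbers, which underlies Erdos' elementary estimates of \<open>p(M)\<close>. A lost
  power of \<open>M\<close> does no harm: \<open>M\<close> is at most a constant times a power of
  \<open>Nbar\<close>, and since \<open>chi\<close> tends to infinity, the Chernoff exponent exceeds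
  every fixed multiple of \<open>ln Nbar\<close>. The two forms of \<Delta> reflect two regimes. For
  \<open>d > 2\<close> the variance is at most of order \<open>Nbar\<close>, and the tilt that
  balances it stays below \<open>b\<close>, which is at least of order
  \<open>Nbar powr (-1/d)\<close>. For \<open>d \<le> 2\<close> the lowest levels matter most, and
  the tilt is capped by \<open>b\<close>, because the generating function of level 1 has its
  singularity at distance \<open>b\<close>; hence the fixed fraction \<open>b / 2\<close>.\<close>

definition neg_binom :: "real \<Rightarrow> nat \<Rightarrow> real" where
  "neg_binom a n = (real n + a - 1) gchoose n"

lemma neg_binom_0 [simp]: "neg_binom a 0 = 1"
  by (simp add: neg_binom_def)

lemma neg_binom_pos: "a > 0 \<Longrightarrow> neg_binom a n > 0"
  by (simp add: neg_binom_def gbinomial_pochhammer' pochhammer_pos)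

lemma neg_binom_sums:
  assumes "\<bar>x\<bar> < 1"
  shows "(\<lambda>n. neg_binom a n * x ^ n) sums (1 - x) powr (-a)"
proof -
  have "(\<lambda>n. (-a gchoose n) * (-x) ^ n) sums (1 + (-x)) powr (-a)"
    by (rule gen_binomial_real) (use assms in auto)
  moreover have "(-a gchoose n) * (-x) ^ n = neg_binom a n * x ^ n" for n
    by (simp add: neg_binom_def gbinomial_minus add.commute power_mult_distrib[symmetric]
        mult.commute mult.left_commute)
  ultimately show ?thesis by simp
qed

text \<open>Coefficient comparison in \<open>x F' = a x / (1 - x) F\<close> for
  \<open>F = (1 - x) powr (-a)\<close>, where the factor \<open>1 / (1 - x)\<close> produces partial
  sums. The proof itself uses parallel summation of binomials and absorption.\<close>

lemma neg_binom_recurrence: "real n * neg_binom a n = a * (\<Sum>i<n. neg_binom a i)"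
proof (cases n)
  case (Suc m)
  have "(\<Sum>i<n. neg_binom a i) = (\<Sum>i\<le>m. ((a - 1) + of_nat i) gchoose i)"
    by (simp add: Suc lessThan_Suc_atMost neg_binom_def algebra_simps)
  also have "\<dots> = (a + real m) gchoose m"
    by (subst gbinomial_parallel_sum) (simp add: algebra_simps)
  finally have s: "(\<Sum>i<n. neg_binom a i) = (a + real m) gchoose m" .
  have "a * ((a + real m) gchoose m) = real (Suc m) * ((a + real m) gchoose Suc m)"
    using gbinomial_mult_1[of "a + real m" m] by (simp add: algebra_simps)
  then show ?thesis unfolding s by (simp add: Suc neg_binom_def algebra_simps)
qed simp

section \<open>Configurations and their weights\<close>

lemma weight_eq_prod:
  assumes "finite S" "{j. N j \<noteq> 0} \<subseteq> S"
  shows "weight q N = (\<Prod>j\<in>S. neg_binom (q j) (N j))"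
proof -
  have "weight q N = (\<Prod>j\<in>{j. N j \<noteq> 0}. neg_binom (q j) (N j))"
    by (simp add: weight_def neg_binom_def)
  also have "\<dots> = (\<Prod>j\<in>S. neg_binom (q j) (N j))"
    by (rule prod.mono_neutral_left) (use assms in auto)
  finally show ?thesis .
qed

text \<open>With a summation range \<open>{1..K}\<close> that does not depend on the energy bound,
  members of \<open>Omega (M - j * l)\<close> and of \<open>Omega M\<close> can be compared term by
  term.\<close>

lemma Omega_iff:
  assumes "M \<le> K"
  shows "N \<in> Omega M \<longleftrightarrow> N 0 = 0 \<and> (\<forall>j>K. N j = 0) \<and> (\<Sum>j=1..K. j * N j) \<le> M"
    (is "_ \<longleftrightarrow> ?R")
proof -
  have eq: "(\<Sum>j\<in>{j. N j \<noteq> 0}. j * N j) = (\<Sum>j=1..K. j * N j)"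
    if "N 0 = 0" "\<forall>j>K. N j = 0" for N :: "nat \<Rightarrow> nat"
  proof (rule sum.mono_neutral_left)
    show "{j. N j \<noteq> 0} \<subseteq> {1..K}"
    proof
      fix j assume "j \<in> {j. N j \<noteq> 0}"
      then have "N j \<noteq> 0" by simp
      with that have "j \<noteq> 0" "\<not> j > K" by (intro notI; simp)+
      then show "j \<in> {1..K}" by simp
    qed
  qed auto
  show ?thesis
  proof
    assume N: "N \<in> Omega M"
    have "N j = 0" if "j > K" for j
    proof (rule ccontr)
      assume "N j \<noteq> 0"
      then have "j * N j \<le> (\<Sum>j\<in>{j. N j \<noteq> 0}. j * N j)"
        using N by (intro member_le_sum) (auto simp: Omega_def)
      also have "\<dots> \<le> M" using N by (simp add: Omega_def)
      finally have "j * N j < j" using assms that by linarith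
      with \<open>N j \<noteq> 0\<close> show False by simp
    qed
    with N eq[of N] show ?R by (simp add: Omega_def)
  next
    assume R: ?R
    then have "{j. N j \<noteq> 0} \<subseteq> {..K}" by (force intro: leI)
    then have "finite {j. N j \<noteq> 0}" by (rule finite_subset) simp
    with R eq[of N] show "N \<in> Omega M" by (simp add: Omega_def)
  qed
qed

lemma Omega_support: "N \<in> Omega M \<Longrightarrow> {j. N j \<noteq> 0} \<subseteq> {1..M}"
proof
  fix j assume "N \<in> Omega M" "j \<in> {j. N j \<noteq> 0}"
  then have N: "N 0 = 0" "\<forall>j>M. N j = 0" "N j \<noteq> 0" using Omega_iff[of M M N] by auto
  then have "j \<noteq> 0" "\<not> j > M" by (intro notI; simp)+
  then show "j \<in> {1..M}" by simp
qed

lemma weight_Omega: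
  "N \<in> Omega M \<Longrightarrow> weight q N = (\<Prod>j=1..M. neg_binom (q j) (N j))"
  by (rule weight_eq_prod) (use Omega_support in auto)

lemma weight_nonneg:
  assumes "\<And>j. j \<ge> 1 \<Longrightarrow> q j > 0" "N \<in> Omega M"
  shows "weight q N \<ge> 0"
  unfolding weight_Omega[OF assms(2)]
  by (intro prod_nonneg ballI less_imp_le[OF neg_binom_pos] assms(1)) auto

lemma total_weight_mono:
  assumes "\<And>j. j \<ge> 1 \<Longrightarrow> q j > 0" "A \<subseteq> B" "B \<subseteq> Omega M"
  shows "total_weight q A \<le> total_weight q B"
  unfolding total_weight_def
  using assms finite_subset[OF assms(3) finite_Omega]
  by (intro sum_mono2) (auto intro: weight_nonneg)

lemma total_weight_Omega_ge_1:
  assumes "\<And>j. j \<ge> 1 \<Longrightarrow> q j > 0"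
  shows "total_weight q (Omega M) \<ge> 1"
proof -
  have "total_weight q {\<lambda>_. 0} \<le> total_weight q (Omega M)"
    by (rule total_weight_mono[where M = M]) (auto intro!: assms simp: Omega_def)
  then show ?thesis by (simp add: total_weight_def weight_def)
qed

text \<open>By \<open>neg_binom_recurrence\<close> the factor \<open>N j\<close> becomes a sum over
  the removal of \<open>l \<ge> 1\<close> particles from level \<open>j\<close>. Removal is a
  bijection onto pairs of \<open>l\<close> and a configuration of energy at most
  \<open>M - j * l\<close>.\<close>

lemma sum_occupation:
  assumes j: "j \<ge> 1" "j \<le> M"
  shows "(\<Sum>N\<in>Omega M. real (N j) * weight q N)
    = q j * (\<Sum>l=1..M div j. total_weight q (Omega (M - j * l)))"
proof -
  \<comment> \<open>Adding \<open>j * N j\<close> on the left avoids truncated subtraction on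
    \<open>nat\<close>.\<close>
  have upd: "(\<Sum>i=1..M. i * (N(j := n)) i) + j * N j = (\<Sum>i=1..M. i * N i) + j * n"
    for N :: "nat \<Rightarrow> nat" and n
  proof -
    have "(\<Sum>i=1..M. i * (N(j := n)) i) = j * n + (\<Sum>i\<in>{1..M} - {j}. i * N i)"
      using j by (subst sum.remove[of _ j]) (auto intro!: sum.cong)
    moreover have "(\<Sum>i=1..M. i * N i) = j * N j + (\<Sum>i\<in>{1..M} - {j}. i * N i)"
      using j by (subst sum.remove[of _ j]) auto
    ultimately show ?thesis by simp
  qed
  have w: "real (N j) * weight q N = q j * (\<Sum>l=1..N j. weight q (N(j := N j - l)))"
    if N: "N \<in> Omega M" for N
  proof -
    let ?P = "\<Prod>i\<in>{1..M} - {j}. neg_binom (q i) (N i)"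
    have wN: "weight q (N(j := n)) = neg_binom (q j) n * ?P" for n
    proof -
      have "{i. (N(j := n)) i \<noteq> 0} \<subseteq> {1..M}" using Omega_support[OF N] j by auto
      then have "weight q (N(j := n)) = (\<Prod>i=1..M. neg_binom (q i) ((N(j := n)) i))"
        by (intro weight_eq_prod) auto
      also have "\<dots> = neg_binom (q j) n * ?P"
        using j by (subst prod.remove[of _ j]) (auto intro!: prod.cong)
      finally show ?thesis .
    qed
    have "(\<Sum>l=1..N j. weight q (N(j := N j - l))) = (\<Sum>l=1..N j. neg_binom (q j) (N j - l)) * ?P"
      by (simp only: wN sum_distrib_right)
    also have "(\<Sum>l=1..N j. neg_binom (q j) (N j - l)) = (\<Sum>i<N j. neg_binom (q j) i)"
      by (rule sum.reindex_bij_witness[of _ "\<lambda>i. N j - i" "\<lambda>i. N j - i"]) auto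
    finally show ?thesis
      using wN[of "N j"] neg_binom_recurrence[of "N j" "q j"] by (simp del: fun_upd_apply)
  qed
  have "(\<Sum>N\<in>Omega M. real (N j) * weight q N)
      = q j * (\<Sum>N\<in>Omega M. \<Sum>l=1..N j. weight q (N(j := N j - l)))"
    by (simp add: w sum_distrib_left)
  also have "(\<Sum>N\<in>Omega M. \<Sum>l=1..N j. weight q (N(j := N j - l)))
      = (\<Sum>(N,l)\<in>Sigma (Omega M) (\<lambda>N. {1..N j}). weight q (N(j := N j - l)))"
    by (rule sum.Sigma) (auto simp: finite_Omega)
  also have "\<dots> = (\<Sum>(l,N)\<in>Sigma {1..M div j} (\<lambda>l. Omega (M - j * l)). weight q N)"
  proof (rule sum.reindex_bij_witness[of _ "\<lambda>(l,N). (N(j := N j + l), l)" "\<lambda>(N,l). (l, N(j := N j - l))"])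
    fix x assume "x \<in> Sigma (Omega M) (\<lambda>N. {1..N j})"
    then obtain N l where x: "x = (N, l)" and N: "N \<in> Omega M" and l: "1 \<le> l" "l \<le> N j" by auto
    have O: "N 0 = 0" "\<forall>i>M. N i = 0" "(\<Sum>i=1..M. i * N i) \<le> M"
      using N Omega_iff[of M M N] by auto
    have le: "j * N j \<le> (\<Sum>i=1..M. i * N i)" using j by (intro member_le_sum) auto
    have "j * l \<le> j * N j" using l by simp
    then have jl: "j * l \<le> M" using le O by linarith
    have "l \<le> M div j" using jl j by (simp add: less_eq_div_iff_mult_less_eq mult.commute)
    moreover have "(\<Sum>i=1..M. i * (N(j := N j - l)) i) \<le> M - j * l"
      using upd[of N "N j - l"] O(3) l \<open>j * l \<le> j * N j\<close> by (simp add: diff_mult_distrib2 del: fun_upd_apply)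
    ultimately show "(case x of (N, l) \<Rightarrow> (l, N(j := N j - l))) \<in> Sigma {1..M div j} (\<lambda>l. Omega (M - j * l))"
      using O(1,2) j l Omega_iff[of "M - j * l" M "N(j := N j - l)"] by (auto simp: x)
    show "(case (case x of (N, l) \<Rightarrow> (l, N(j := N j - l))) of (l, N) \<Rightarrow> (N(j := N j + l), l)) = x"
      using l by (simp add: x)
  next
    fix x assume "x \<in> Sigma {1..M div j} (\<lambda>l. Omega (M - j * l))"
    then obtain N l where x: "x = (l, N)" and N: "N \<in> Omega (M - j * l)" and l: "1 \<le> l" "l \<le> M div j"
      by auto
    have O: "N 0 = 0" "\<forall>i>M. N i = 0" "(\<Sum>i=1..M. i * N i) \<le> M - j * l"
      using N Omega_iff[of "M - j * l" M N] by auto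
    have "j * l \<le> M" using l j by (simp add: less_eq_div_iff_mult_less_eq mult.commute)
    then have "(\<Sum>i=1..M. i * (N(j := N j + l)) i) \<le> M"
      using upd[of N "N j + l"] O(3) by (simp add: distrib_left del: fun_upd_apply)
    then show "(case x of (l, N) \<Rightarrow> (N(j := N j + l), l)) \<in> Sigma (Omega M) (\<lambda>N. {1..N j})"
      using O(1,2) j l Omega_iff[of M M "N(j := N j + l)"] by (auto simp: x)
    show "(case (case x of (l, N) \<Rightarrow> (N(j := N j + l), l)) of (N, l) \<Rightarrow> (l, N(j := N j - l))) = x"
      by (simp add: x)
  qed auto
  also have "\<dots> = (\<Sum>l=1..M div j. total_weight q (Omega (M - j * l)))"
    unfolding total_weight_def by (rule sum.Sigma[symmetric]) (auto simp: finite_Omega)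
  finally show ?thesis .
qed

text \<open>For \<open>q = 1\<close> the sum of divisors; in general the coefficient of
  \<open>x ^ k\<close> in \<open>x\<close> times the logarithmic derivative of the product over
  \<open>j\<close> of \<open>(1 - x ^ j) powr (- q j)\<close>.\<close>

definition div_sum :: "(nat \<Rightarrow> real) \<Rightarrow> nat \<Rightarrow> real" where
  "div_sum q k = (\<Sum>j | j dvd k. real j * q j)"

text \<open>
  Both sides come from computing \<open>\<Sum>\<^sub>N (\<Sum>\<^sub>j j N\<^sub>j) w(N)\<close> over \<^term>\<open>Omega M\<close>, in which
  \<open>\<Sum>\<^sub>j j N\<^sub>j \<le> M\<close>.
\<close>

lemma total_weight_recurrence:
  assumes "\<And>j. j \<ge> 1 \<Longrightarrow> q j > 0"
  shows "(\<Sum>k=1..M. div_sum q k * total_weight q (Omega (M - k)))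
    \<le> real M * total_weight q (Omega M)"
proof -
  let ?W = "\<lambda>m. total_weight q (Omega m)"
  have "(\<Sum>k=1..M. div_sum q k * ?W (M - k))
      = (\<Sum>k=1..M. \<Sum>j | j dvd k. real j * q j * ?W (M - k))"
    by (simp add: div_sum_def sum_distrib_right)
  also have "\<dots> = (\<Sum>(k,j)\<in>Sigma {1..M} (\<lambda>k. {j. j dvd k}). real j * q j * ?W (M - k))"
    by (rule sum.Sigma) auto
  also have "\<dots> = (\<Sum>(j,l)\<in>Sigma {1..M} (\<lambda>j. {1..M div j}). real j * q j * ?W (M - j * l))"
  proof (rule sum.reindex_bij_witness[of _ "\<lambda>(j,l). (j * l, j)" "\<lambda>(k,j). (j, k div j)"])
    fix x assume "x \<in> Sigma {1..M} (\<lambda>k. {j. j dvd k})"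
    then obtain k j where x: "x = (k, j)" "j dvd k" "1 \<le> k" "k \<le> M" by auto
    then have "0 < j" "j \<le> k" using dvd_pos_nat[of k j] dvd_imp_le[of j k] by simp_all
    then have "0 < k div j" by (simp add: div_greater_zero_iff)
    with x \<open>0 < j\<close> \<open>j \<le> k\<close> show "(case x of (k, j) \<Rightarrow> (j, k div j)) \<in> Sigma {1..M} (\<lambda>j. {1..M div j})"
      by (auto simp: div_le_mono)
  next
    fix x assume "x \<in> Sigma {1..M} (\<lambda>j. {1..M div j})"
    then show "(case x of (j, l) \<Rightarrow> (j * l, j)) \<in> Sigma {1..M} (\<lambda>k. {j. j dvd k})"
      by (auto simp: less_eq_div_iff_mult_less_eq mult.commute)
  qed auto
  also have "\<dots> = (\<Sum>j=1..M. \<Sum>l=1..M div j. real j * q j * ?W (M - j * l))"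
    by (rule sum.Sigma[symmetric]) auto
  also have "\<dots> = (\<Sum>j=1..M. real j * (\<Sum>N\<in>Omega M. real (N j) * weight q N))"
    by (intro sum.cong refl, subst sum_occupation) (auto simp: sum_distrib_left mult.assoc)
  also have "\<dots> = (\<Sum>j=1..M. \<Sum>N\<in>Omega M. real j * real (N j) * weight q N)"
    by (simp add: sum_distrib_left mult_ac)
  also have "\<dots> = (\<Sum>N\<in>Omega M. \<Sum>j=1..M. real j * real (N j) * weight q N)"
    by (rule sum.swap)
  also have "\<dots> = (\<Sum>N\<in>Omega M. real (\<Sum>j=1..M. j * N j) * weight q N)"
    by (simp add: sum_distrib_right)
  also have "\<dots> \<le> (\<Sum>N\<in>Omega M. real M * weight q N)"
    by (intro sum_mono mult_right_mono weight_nonneg)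
       (use assms Omega_iff[of M M] in \<open>auto simp del: of_nat_sum of_nat_mult\<close>)
  also have "\<dots> = real M * ?W M"
    by (simp add: total_weight_def sum_distrib_left)
  finally show ?thesis .
qed

text \<open>All terms are nonnegative, so the energy constraint may be relaxed to the box of
  occupation numbers up to \<open>M\<close>. There the sum factorises, and each factor is a partial
  sum of a negative binomial series.\<close>

lemma weighted_generating_bound:
  assumes "\<And>j. j \<ge> 1 \<Longrightarrow> q j > 0" and x: "\<And>j. j \<ge> 1 \<Longrightarrow> 0 \<le> x j \<and> x j < 1"
  shows "(\<Sum>N\<in>Omega M. weight q N * (\<Prod>j=1..M. x j ^ N j)) \<le> (\<Prod>j=1..M. (1 - x j) powr (- q j))"
proof -
  let ?g = "\<lambda>j n. neg_binom (q j) n * x j ^ n"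
  have g0: "?g j n \<ge> 0" if "j \<in> {1..M}" for j n
    using that assms by (auto intro!: mult_nonneg_nonneg less_imp_le[OF neg_binom_pos])
  have bd: "N j \<le> M" if "N \<in> Omega M" "j \<in> {1..M}" for N j
  proof -
    have "N j \<le> j * N j" using that by simp
    also have "\<dots> \<le> (\<Sum>i=1..M. i * N i)" using that by (intro member_le_sum) auto
    also have "\<dots> \<le> M" using that Omega_iff[of M M N] by simp
    finally show ?thesis .
  qed
  \<comment> \<open>Configurations vanish outside \<open>{1..M}\<close>, members of
    \<open>PiE\<close> are \<open>undefined\<close> there; \<open>restrict\<close> translates
    without losing information.\<close>
  have inj: "inj_on (\<lambda>N. restrict N {1..M}) (Omega M)"
  proof (rule inj_onI)
    fix N N' :: "nat \<Rightarrow> nat"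
    assume N: "N \<in> Omega M" "N' \<in> Omega M" "restrict N {1..M} = restrict N' {1..M}"
    have "N j = N' j" for j
    proof (cases "j \<in> {1..M}")
      case True
      then show ?thesis using N(3) by (metis restrict_apply')
    next
      case False
      then have "N j = 0" "N' j = 0" using Omega_support[OF N(1)] Omega_support[OF N(2)] by blast+
      then show ?thesis by simp
    qed
    then show "N = N'" by auto
  qed
  have "(\<Sum>N\<in>Omega M. weight q N * (\<Prod>j=1..M. x j ^ N j)) = (\<Sum>N\<in>Omega M. \<Prod>j=1..M. ?g j (N j))"
    by (simp add: weight_Omega prod.distrib)
  also have "\<dots> = (\<Sum>h\<in>(\<lambda>N. restrict N {1..M}) ` Omega M. \<Prod>j=1..M. ?g j (h j))"
    by (subst sum.reindex[OF inj]) simp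
  also have "\<dots> \<le> (\<Sum>h\<in>PiE {1..M} (\<lambda>_. {..M}). \<Prod>j=1..M. ?g j (h j))"
  proof (rule sum_mono2)
    show "(\<lambda>N. restrict N {1..M}) ` Omega M \<subseteq> PiE {1..M} (\<lambda>_. {..M})" using bd by auto
    show "(\<Prod>j=1..M. ?g j (h j)) \<ge> 0" for h by (intro prod_nonneg ballI g0)
  qed (simp add: finite_PiE)
  also have "\<dots> = (\<Prod>j=1..M. \<Sum>n\<le>M. ?g j n)"
    by (rule prod_sum_PiE[symmetric]) auto
  also have "\<dots> \<le> (\<Prod>j=1..M. (1 - x j) powr (- q j))"
  proof (intro prod_mono conjI sum_nonneg g0)
    fix j assume j: "j \<in> {1..M}"
    have s: "?g j sums (1 - x j) powr (- q j)"
      by (rule neg_binom_sums) (use x j in auto)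
    show "(\<Sum>n\<le>M. ?g j n) \<le> (1 - x j) powr (- q j)"
      using sum_le_suminf[OF sums_summable[OF s], of "{..M}"] g0[OF j] sums_unique[OF s] by auto
  qed auto
  finally show ?thesis .
qed

section \<open>Sums of powers times exponentials\<close>

lemma bounded_finite_sums:
  fixes f :: "'a \<Rightarrow> real"
  assumes "\<And>x. x \<in> A \<Longrightarrow> f x \<ge> 0" and "\<And>F. finite F \<Longrightarrow> F \<subseteq> A \<Longrightarrow> sum f F \<le> B"
  shows "f summable_on A" "infsum f A \<le> B"
proof -
  show s: "f summable_on A"
    by (rule nonneg_bdd_above_summable_on) (auto intro!: bdd_aboveI[of _ B] assms)
  show "infsum f A \<le> B"
    by (rule infsum_le_finite_sums[OF s assms(2)])
qed

lemma has_sum_exp: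
  assumes "(c::real) > 0"
  shows "((\<lambda>k. exp (-(c * real k))) has_sum 1 / (exp c - 1)) {1..}"
proof -
  have "((\<lambda>k. exp (-c) ^ k) has_sum exp (-c) / (1 - exp (-c))) {1..}"
    by (rule has_sum_geometric_from_1) (use assms in auto)
  moreover have "exp (-c) / (1 - exp (-c)) = 1 / (exp c - 1)"
    using assms by (simp add: exp_minus field_simps)
  moreover have "exp (-c) ^ k = exp (-(c * real k))" for k
    by (simp add: exp_of_nat_mult[symmetric] mult.commute)
  ultimately show ?thesis by simp
qed

lemma sum_exp_le:
  assumes "(c::real) > 0" "finite F" "F \<subseteq> {1..}"
  shows "(\<Sum>k\<in>F. exp (-(c * real k))) \<le> 1 / c"
proof -
  have "(\<Sum>k\<in>F. exp (-(c * real k))) \<le> 1 / (exp c - 1)"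
    by (rule finite_sum_le_has_sum[OF has_sum_exp[OF assms(1)]]) (use assms in auto)
  also have "\<dots> \<le> 1 / c"
  proof (rule divide_left_mono)
    show "c \<le> exp c - 1" using exp_ge_add_one_self[of c] by linarith
  qed (use assms in auto)
  finally show ?thesis .
qed

text \<open>The left side is largest at \<open>y = 2 * p\<close>, whence the tangent to
  \<open>ln\<close> at that point. The constant is \<open>(2 * p) powr p\<close> for
  \<open>p > 0\<close>, but written with \<open>exp\<close> so that it equals 1 at
  \<open>p = 0\<close>, where \<open>0 powr 0 = 0\<close> would be wrong.\<close>

lemma powr_mult_exp_le:
  fixes p y :: real
  assumes "p \<ge> 0" "y > 0"
  shows "y powr p * exp (-(y / 2)) \<le> exp (p * ln (2 * p))"
proof (cases "p = 0")
  case False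
  then have p: "p > 0" using assms by simp
  have "ln (y / (2 * p)) \<le> y / (2 * p) - 1" by (rule ln_le_minus_one) (use p assms in auto)
  then have "p * (ln y - ln (2 * p)) \<le> p * (y / (2 * p) - 1)"
    using p assms by (intro mult_left_mono) (auto simp: ln_div)
  also have "\<dots> \<le> y / 2" using p by (simp add: field_simps)
  finally have "p * ln y - y / 2 \<le> p * ln (2 * p)" by (simp add: algebra_simps)
  moreover have "y powr p * exp (-(y / 2)) = exp (p * ln y - y / 2)"
    using assms by (simp add: powr_def exp_add[symmetric])
  ultimately show ?thesis by simp
qed (use assms in simp)

text \<open>Comparison with the integral of a decreasing power, telescoped by the mean value
  theorem. The interval starting at 0 is separate because the power need not be differentiable
  there.\<close>

lemma sum_powr_le:
  fixes p :: real
  assumes "-1 < p" "p \<le> 0"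
  shows "(\<Sum>k=1..n. real k powr p) \<le> real n powr (p + 1) / (p + 1)"
proof (induction n)
  case (Suc n)
  have "(p + 1) * real (Suc n) powr p \<le> real (Suc n) powr (p + 1) - real n powr (p + 1)"
  proof (cases "n = 0")
    case False
    have "\<exists>z. real n < z \<and> z < real (Suc n) \<and> real (Suc n) powr (p + 1) - real n powr (p + 1)
        = (real (Suc n) - real n) * ((p + 1) * z powr p)"
      using False by (intro MVT2) (auto intro!: derivative_eq_intros)
    then obtain z where z: "real n < z" "z < real (Suc n)"
      "real (Suc n) powr (p + 1) - real n powr (p + 1) = (p + 1) * z powr p" by auto
    have "real (Suc n) powr p \<le> z powr p"
      using z assms False by (intro powr_mono2') auto
    with z assms show ?thesis by simp
  qed (use assms in simp)
  then have "real (Suc n) powr p \<le> real (Suc n) powr (p + 1) / (p + 1) - real n powr (p + 1) / (p + 1)"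
    using assms by (simp add: diff_divide_distrib[symmetric] pos_le_divide_eq mult.commute)
  with Suc show ?case by simp
qed simp

text \<open>For \<open>p \<ge> 0\<close> half of the exponential absorbs the power and the other
  half is summed geometrically. For \<open>p < 0\<close> the sum is split at \<open>1 / b\<close>:
  below, the exponential is dropped; above, the power is replaced by its value at
  \<open>1 / b\<close>.\<close>

lemma sum_powr_exp_upper:
  fixes p :: real
  assumes p: "p > -1"
  obtains K where "K > 0"
    "\<And>b. b > 0 \<Longrightarrow> (\<lambda>k. real k powr p * exp (-(b * real k))) summable_on {1..}"
    "\<And>b. b > 0 \<Longrightarrow> (\<Sum>\<^sub>\<infinity>k\<in>{1..}. real k powr p * exp (-(b * real k))) \<le> K * b powr (-(p + 1))"
proof -
  have "\<exists>K>0. \<forall>b>0. \<forall>F. finite F \<longrightarrow> F \<subseteq> {1..} \<longrightarrow>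
    (\<Sum>k\<in>F. real k powr p * exp (-(b * real k))) \<le> K * b powr (-(p + 1))"
  proof (cases "p \<ge> 0")
    case True
    define K where "K = exp (p * ln (2 * p))"
    have "(\<Sum>k\<in>F. real k powr p * exp (-(b * real k))) \<le> (2 * K) * b powr (-(p + 1))"
      if b: "b > 0" and F: "finite F" "F \<subseteq> {1..}" for b F
    proof -
      have "real k powr p * exp (-(b * real k)) \<le> K * b powr (-p) * exp (-((b / 2) * real k))"
        if "k \<in> F" for k
      proof -
        have k: "real k > 0" using that F by auto
        have "b powr (-p) * ((b * real k) powr p * exp (-(b * real k / 2))) \<le> b powr (-p) * K"
          unfolding K_def using True b k by (intro mult_left_mono powr_mult_exp_le) auto
        moreover have "b powr (-p) * (b * real k) powr p = real k powr p"
          using b k by (simp add: powr_mult powr_minus field_simps)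
        ultimately have "real k powr p * exp (-(b * real k / 2)) \<le> K * b powr (-p)"
          by (simp add: mult.assoc[symmetric] mult.commute)
        then have "real k powr p * exp (-(b * real k / 2)) * exp (-(b * real k / 2))
            \<le> K * b powr (-p) * exp (-(b * real k / 2))"
          by (intro mult_right_mono) auto
        moreover have "exp (-(b * real k / 2)) * exp (-(b * real k / 2)) = exp (-(b * real k))"
          by (simp add: exp_add[symmetric])
        ultimately show ?thesis by (simp add: mult.assoc)
      qed
      then have "(\<Sum>k\<in>F. real k powr p * exp (-(b * real k)))
          \<le> (\<Sum>k\<in>F. K * b powr (-p) * exp (-((b / 2) * real k)))"
        by (intro sum_mono)
      also have "\<dots> = K * b powr (-p) * (\<Sum>k\<in>F. exp (-((b / 2) * real k)))"
        by (simp only: sum_distrib_left)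
      also have "\<dots> \<le> K * b powr (-p) * (1 / (b / 2))"
        using b F by (intro mult_left_mono sum_exp_le) (auto simp: K_def)
      also have "\<dots> = (2 * K) * b powr (-(p + 1))"
        using b by (simp add: powr_diff)
      finally show ?thesis .
    qed
    moreover have "2 * K > 0" by (simp add: K_def)
    ultimately show ?thesis by blast
  next
    case False
    define K where "K = 1 / (p + 1) + 1"
    have "(\<Sum>k\<in>F. real k powr p * exp (-(b * real k))) \<le> K * b powr (-(p + 1))"
      if b: "b > 0" and F: "finite F" "F \<subseteq> {1..}" for b F
    proof -
      define n where "n = nat \<lfloor>1 / b\<rfloor>"
      have n: "real n \<le> 1 / b" using b by (simp add: n_def)
      have nn: "k \<le> n \<longleftrightarrow> real k \<le> 1 / b" for k :: nat
        using b by (simp add: n_def le_nat_iff le_floor_iff)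
      have inv: "(1 / b) powr r = b powr (-r)" for r
        using b by (simp add: powr_minus powr_divide inverse_eq_divide)
      have "(\<Sum>k\<in>F. real k powr p * exp (-(b * real k)))
          = (\<Sum>k\<in>F \<inter> {..n}. real k powr p * exp (-(b * real k)))
          + (\<Sum>k\<in>F - {..n}. real k powr p * exp (-(b * real k)))"
        using F(1) by (rule sum.Int_Diff)
      also have "(\<Sum>k\<in>F \<inter> {..n}. real k powr p * exp (-(b * real k))) \<le> (\<Sum>k\<in>F \<inter> {..n}. real k powr p)"
        using b by (intro sum_mono) (auto intro!: mult_left_le)
      also have "\<dots> \<le> (\<Sum>k=1..n. real k powr p)"
        using F by (intro sum_mono2) auto
      also have "\<dots> \<le> real n powr (p + 1) / (p + 1)"
        using p False by (intro sum_powr_le) auto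
      also have "\<dots> \<le> (1 / b) powr (p + 1) / (p + 1)"
        using p n by (intro divide_right_mono powr_mono2) auto
      also have "(1 / b) powr (p + 1) = b powr (-(p + 1))" by (rule inv)
      also have "(\<Sum>k\<in>F - {..n}. real k powr p * exp (-(b * real k)))
          \<le> (\<Sum>k\<in>F - {..n}. (1 / b) powr p * exp (-(b * real k)))"
        using F b False nn by (intro sum_mono mult_right_mono powr_mono2') auto
      also have "\<dots> = (1 / b) powr p * (\<Sum>k\<in>F - {..n}. exp (-(b * real k)))"
        by (simp only: sum_distrib_left)
      also have "\<dots> \<le> (1 / b) powr p * (1 / b)"
        using b F by (intro mult_left_mono sum_exp_le) auto
      also have "\<dots> = b powr (-(p + 1))"
        using b by (simp add: inv powr_diff)
      finally show ?thesis by (simp add: K_def field_simps)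
    qed
    moreover have "K > 0" using p by (simp add: K_def add_pos_pos)
    ultimately show ?thesis by blast
  qed
  then obtain K where K: "K > 0" "\<And>b F. b > 0 \<Longrightarrow> finite F \<Longrightarrow> F \<subseteq> {1..} \<Longrightarrow>
      (\<Sum>k\<in>F. real k powr p * exp (-(b * real k))) \<le> K * b powr (-(p + 1))" by auto
  show ?thesis
    by (rule that[OF K(1)]; rule bounded_finite_sums[OF _ K(2)]) auto
qed

text \<open>The block of indices between \<open>n\<close> and \<open>2 * n\<close>, with
  \<open>n\<close> about \<open>1 / b\<close>, already has the right order: its \<open>n\<close>
  terms are all comparable. The bound \<open>B\<close> keeps \<open>b * n\<close> bounded when
  \<open>1 / b\<close> is rounded up.\<close>

lemma sum_powr_exp_lower:
  fixes p b B :: real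
  assumes "p \<ge> 0" "0 < b" "b \<le> B"
    and s: "(\<lambda>k. real k powr p * exp (-(b * real k))) summable_on {1..}"
  shows "exp (-2 * (1 + B)) * b powr (-(p + 1)) \<le> (\<Sum>\<^sub>\<infinity>k\<in>{1..}. real k powr p * exp (-(b * real k)))"
proof -
  define n where "n = nat \<lceil>1 / b\<rceil>"
  have n: "1 / b \<le> real n" "real n \<le> 1 / b + 1"
    using assms real_nat_ceiling_ge[of "1 / b"] of_int_ceiling_le_add_one[of "1 / b"]
    by (simp_all add: n_def)
  have bn: "b * real n \<le> 1 + B"
  proof -
    have "b * real n \<le> b * (1 / b + 1)" using n(2) assms by (intro mult_left_mono) auto
    also have "\<dots> = 1 + b" using assms by (simp add: field_simps)
    finally show ?thesis using assms by simp
  qed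
  have term_ge: "b powr (-p) * exp (-2 * (1 + B)) \<le> real k powr p * exp (-(b * real k))"
    if "k \<in> {n<..2*n}" for k
  proof (rule mult_mono)
    have "1 / b \<le> real k" using n(1) that by simp
    then have "(1 / b) powr p \<le> real k powr p" using assms by (intro powr_mono2) auto
    then show "b powr (-p) \<le> real k powr p"
      using assms by (simp add: powr_minus powr_divide inverse_eq_divide)
    have "b * real k \<le> b * (2 * real n)" using that assms by (intro mult_left_mono) auto
    with bn show "exp (-2 * (1 + B)) \<le> exp (-(b * real k))" by simp
  qed auto
  have "exp (-2 * (1 + B)) * b powr (-(p + 1)) = (1 / b) * (b powr (-p) * exp (-2 * (1 + B)))"
    using assms by (simp add: powr_diff)
  also have "\<dots> \<le> real n * (b powr (-p) * exp (-2 * (1 + B)))"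
    by (intro mult_right_mono n) auto
  also have "\<dots> = (\<Sum>k\<in>{n<..2*n}. b powr (-p) * exp (-2 * (1 + B)))" by simp
  also have "\<dots> \<le> (\<Sum>k\<in>{n<..2*n}. real k powr p * exp (-(b * real k)))"
    by (intro sum_mono term_ge)
  also have "\<dots> \<le> (\<Sum>\<^sub>\<infinity>k\<in>{1..}. real k powr p * exp (-(b * real k)))"
    by (rule finite_sum_le_infsum[OF s]) auto
  finally show ?thesis .
qed

text \<open>Rearrangement of a Lambert series: with \<open>k = j * l\<close>, summation over pairs
  \<open>(j, l)\<close> becomes summation over \<open>k\<close> and its divisors. Nonnegativity
  makes the double family summable.\<close>

lemma has_sum_divisor_regroup:
  fixes g :: "nat \<Rightarrow> nat \<Rightarrow> real"
  assumes nonneg: "\<And>j k. j \<ge> 1 \<Longrightarrow> k \<ge> 1 \<Longrightarrow> g j k \<ge> 0"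
    and inner: "\<And>j. j \<ge> 1 \<Longrightarrow> ((\<lambda>l. g j (j * l)) has_sum s j) {1..}"
    and outer: "(s has_sum S) {1..}"
  shows "((\<lambda>k. \<Sum>j | j dvd k. g j k) has_sum S) {1..}"
proof -
  let ?f = "\<lambda>(j,l). g j (j * l)"
  have "?f summable_on Sigma {1..} (\<lambda>_. {1..})"
    by (rule summable_on_SigmaI[where g = s])
       (use inner outer nonneg in \<open>auto intro: has_sum_imp_summable\<close>)
  then have "(?f has_sum S) (Sigma {1..} (\<lambda>_. {1..}))"
    by (intro has_sum_SigmaI[OF _ outer]) (use inner in auto)
  also have "?this \<longleftrightarrow> ((\<lambda>(k,j). g j k) has_sum S) (Sigma {1..} (\<lambda>k. {j. j dvd k}))"
  proof (rule has_sum_reindex_bij_witness[of _ "\<lambda>(k,j). (j, k div j)" "\<lambda>(j,l). (j * l, j)"])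
    fix x :: "nat \<times> nat" assume "x \<in> Sigma {1..} (\<lambda>k. {j. j dvd k})"
    then obtain k j where x: "x = (k, j)" "j dvd k" "1 \<le> k" by auto
    then have "0 < j" "j \<le> k" using dvd_pos_nat[of k j] dvd_imp_le[of j k] by simp_all
    then have "0 < k div j" by (simp add: div_greater_zero_iff)
    with x \<open>0 < j\<close> show "(case x of (k, j) \<Rightarrow> (j, k div j)) \<in> Sigma {1..} (\<lambda>_. {1..})" by simp
    show "(case (case x of (k, j) \<Rightarrow> (j, k div j)) of (j, l) \<Rightarrow> (j * l, j)) = x" using x by simp
  qed auto
  finally have "((\<lambda>(k,j). g j k) has_sum S) (Sigma {1..} (\<lambda>k. {j. j dvd k}))" .
  then show ?thesis
    by (rule has_sum_SigmaD) (auto intro!: has_sum_finiteI)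
qed

lemma has_sum_ln_one_minus:
  assumes "(y::real) > 0"
  shows "((\<lambda>l. exp (-(y * real l)) / real l) has_sum (- ln (1 - exp (-y)))) {1..}"
proof -
  have "(\<lambda>n. - ((- (- exp (-y))) ^ n) / of_nat n) sums ln (1 + (- exp (-y)))"
    by (rule ln_series') (use assms in auto)
  then have "(\<lambda>n. exp (-y) ^ n / real n) sums (- ln (1 - exp (-y)))"
    using sums_minus by fastforce
  then have "((\<lambda>n. exp (-y) ^ n / real n) has_sum (- ln (1 - exp (-y)))) UNIV"
    by (rule sums_nonneg_imp_has_sum) simp
  also have "?this \<longleftrightarrow> ((\<lambda>l. exp (-(y * real l)) / real l) has_sum (- ln (1 - exp (-y)))) {1..}"
    by (rule has_sum_cong_neutral) (auto simp: exp_of_nat_mult[symmetric] mult.commute Suc_le_eq)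
  finally show ?thesis .
qed

section \<open>Power moments of the divisor sums\<close>

text \<open>One lower bound that is linear near 0 and still grows exponentially, so that occupation
  numbers are controlled at low and high levels at once.\<close>

lemma exp_minus_one_ge: "y / 2 * exp (y / 2) \<le> exp y - (1::real)" if "y \<ge> 0"
proof -
  have "y / 2 * exp (y / 2) \<le> (exp (y / 2) - 1) * (exp (y / 2) + 1)"
  proof (rule mult_mono)
    show "y / 2 \<le> exp (y / 2) - 1" using exp_ge_add_one_self[of "y / 2"] by linarith
  qed (use that in auto)
  also have "\<dots> = exp (y / 2) * exp (y / 2) - 1" by (simp add: algebra_simps)
  also have "\<dots> = exp y - 1" by (simp add: exp_add[symmetric])
  finally show ?thesis .
qed

lemma minus_ln_one_minus_exp_le:
  assumes "(y::real) > 0"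
  shows "- ln (1 - exp (-y)) \<le> 1 / (exp y - 1)"
proof -
  have e: "exp y > 1" using assms by simp
  have "- ln (1 - exp (-y)) = ln (inverse (1 - exp (-y)))" by (simp add: ln_inverse)
  also have "inverse (1 - exp (-y)) = 1 + 1 / (exp y - 1)"
    using e by (simp add: exp_minus field_simps)
  also have "ln \<dots> \<le> 1 / (exp y - 1)" by (rule ln_add_one_self_le_self) (use e in simp)
  finally show ?thesis .
qed

text \<open>The asymptotics of \<open>q\<close> are traded for two-sided bounds valid from
  \<open>j = 1\<close> on, so that the constants derived from them do not depend on
  \<open>M\<close>.\<close>

locale boson_gas =
  fixes d c1 c2 :: real and q :: "nat \<Rightarrow> real"
  assumes d_gt_1: "d > 1" and c1_pos: "c1 > 0"
    and q_lower: "j \<ge> 1 \<Longrightarrow> c1 * real j powr (d - 1) \<le> q j"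
    and q_upper: "j \<ge> 1 \<Longrightarrow> q j \<le> c2 * real j powr (d - 1)"
begin

lemma q_pos: "j \<ge> 1 \<Longrightarrow> q j > 0"
  using q_lower[of j] c1_pos by (smt (verit) mult_pos_pos of_nat_0_less_iff powr_gt_zero zero_less_iff_neq_zero not_one_le_zero)

lemma c2_pos: "c2 > 0"
  using q_lower[of 1] q_upper[of 1] c1_pos by simp

text \<open>Every number divides 0, so the index set is infinite and the sum takes its default value
  0.\<close>

lemma div_sum_0 [simp]: "div_sum q 0 = 0"
  by (simp add: div_sum_def)

lemma div_sum_lower:
  assumes "k \<ge> 1"
  shows "c1 * real k powr d \<le> div_sum q k"
proof -
  have "c1 * real k powr d = real k * (c1 * real k powr (d - 1))"
    using assms by (simp add: powr_diff)
  also have "\<dots> \<le> real k * q k" using assms by (intro mult_left_mono q_lower) auto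
  also have "\<dots> \<le> div_sum q k"
    unfolding div_sum_def
  proof (rule member_le_sum)
    fix j assume "j \<in> {j. j dvd k} - {k}"
    then have "j \<ge> 1" using assms dvd_pos_nat[of k j] by simp
    then show "0 \<le> real j * q j" using q_pos[of j] by simp
  qed (use assms in auto)
  finally show ?thesis .
qed

lemma div_sum_nonneg [simp]: "div_sum q k \<ge> 0"
  using div_sum_lower[of k] c1_pos
  by (cases "k = 0") (auto intro: order_trans[of 0 "c1 * real k powr d"])

definition c3 :: real where
  "c3 = c2 * (\<Sum>\<^sub>\<infinity>l\<in>{1..}. real l powr (-d))"

lemma zeta_summable: "(\<lambda>l. real l powr (-d)) summable_on {1..}"
proof -
  have "summable (\<lambda>l. real l powr (-d))"
    using d_gt_1 by (simp add: summable_real_powr_iff)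
  then have "(\<lambda>l. real l powr (-d)) summable_on UNIV"
    by (intro summable_nonneg_imp_summable_on) auto
  then show ?thesis by (rule summable_on_subset) auto
qed

text \<open>Passing to the complementary divisor \<open>l = k / j\<close> turns the sum of
  \<open>j powr d\<close> into \<open>k powr d\<close> times a partial sum of the zeta series at
  \<open>d\<close>, which converges because \<open>d > 1\<close>.\<close>

lemma div_sum_upper:
  assumes "k \<ge> 1"
  shows "div_sum q k \<le> c3 * real k powr d"
proof -
  have dp: "0 < j" if "j dvd k" for j using that assms dvd_pos_nat[of k j] by simp
  have fin: "finite {j. j dvd k}" using assms by simp
  have "div_sum q k \<le> (\<Sum>j | j dvd k. c2 * real j powr d)"
    unfolding div_sum_def
  proof (rule sum_mono)
    fix j assume "j \<in> {j. j dvd k}"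
    then have j: "0 < j" using dp by simp
    then have "real j * q j \<le> real j * (c2 * real j powr (d - 1))"
      by (intro mult_left_mono q_upper) auto
    also have "\<dots> = c2 * real j powr d" using j by (simp add: powr_diff)
    finally show "real j * q j \<le> c2 * real j powr d" .
  qed
  also have "\<dots> = (\<Sum>l | l dvd k. c2 * (real k powr d * real l powr (-d)))"
  proof (rule sum.reindex_bij_witness[of _ "\<lambda>l. k div l" "\<lambda>j. k div j"])
    fix j assume j: "j \<in> {j. j dvd k}"
    then show "k div (k div j) = j" "k div j \<in> {j. j dvd k}" using dp assms by (auto simp: div_dvd_iff_mult)
    from j obtain l where k: "k = j * l" by auto
    with assms have "j > 0" "l > 0" by auto
    then show "c2 * (real k powr d * real (k div j) powr - d) = c2 * real j powr d"
      by (simp add: k powr_mult powr_minus field_simps)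
  next
    fix j assume j: "j \<in> {j. j dvd k}"
    then show "k div (k div j) = j" "k div j \<in> {j. j dvd k}" using dp assms by (auto simp: div_dvd_iff_mult)
  qed
  also have "\<dots> = c2 * real k powr d * (\<Sum>l | l dvd k. real l powr (-d))"
    by (simp add: sum_distrib_left mult.assoc)
  also have "\<dots> \<le> c2 * real k powr d * (\<Sum>\<^sub>\<infinity>l\<in>{1..}. real l powr (-d))"
    using dp fin c2_pos
    by (intro mult_left_mono finite_sum_le_infsum zeta_summable) (auto simp: Suc_le_eq)
  finally show ?thesis by (simp add: c3_def mult_ac)
qed

lemma c3_pos: "c3 > 0"
  using div_sum_lower[of 1] div_sum_upper[of 1] c1_pos by simp

text \<open>
  \<^term>\<open>moment (-1)\<close> is the logarithm of the grand canonical partition function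
  \<open>\<Prod>\<^sub>j (1 - exp (-\<beta>j)) powr (-q j)\<close>, and \<^term>\<open>moment 0\<close>, its negated derivative, is the
  mean energy that defines \<^term>\<open>b_sol q M\<close>.
\<close>

definition moment :: "real \<Rightarrow> real \<Rightarrow> real" where
  "moment r \<beta> = (\<Sum>\<^sub>\<infinity>k\<in>{1..}. real k powr r * div_sum q k * exp (-(\<beta> * real k)))"

lemma moment_term_le:
  assumes "k \<ge> 1"
  shows "real k powr r * div_sum q k * exp (-(\<beta> * real k))
    \<le> c3 * (real k powr (d + r) * exp (-(\<beta> * real k)))"
proof -
  have "real k powr r * div_sum q k * exp (-(\<beta> * real k))
      \<le> real k powr r * (c3 * real k powr d) * exp (-(\<beta> * real k))"
    by (intro mult_left_mono mult_right_mono div_sum_upper assms) auto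
  then show ?thesis by (simp add: powr_add mult_ac)
qed

lemma moment_term_ge:
  assumes "k \<ge> 1"
  shows "c1 * (real k powr (d + r) * exp (-(\<beta> * real k)))
    \<le> real k powr r * div_sum q k * exp (-(\<beta> * real k))"
proof -
  have "real k powr r * (c1 * real k powr d) * exp (-(\<beta> * real k))
    \<le> real k powr r * div_sum q k * exp (-(\<beta> * real k))"
    by (intro mult_left_mono mult_right_mono div_sum_lower assms) auto
  then show ?thesis by (simp add: powr_add mult_ac)
qed

lemma moment_has_sum:
  assumes "r \<ge> -1" "\<beta> > 0"
  shows "((\<lambda>k. real k powr r * div_sum q k * exp (-(\<beta> * real k))) has_sum moment r \<beta>) {1..}"
proof -
  obtain K where "\<And>b. b > 0 \<Longrightarrow> (\<lambda>k. real k powr (d + r) * exp (-(b * real k))) summable_on {1..}"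
    using sum_powr_exp_upper[of "d + r"] assms d_gt_1 by auto
  from summable_on_cmult_right[OF this[OF assms(2)], of c3]
  have "(\<lambda>k. real k powr r * div_sum q k * exp (-(\<beta> * real k))) summable_on {1..}"
    by (rule summable_on_comparison_test) (use moment_term_le div_sum_nonneg in auto)
  then show ?thesis by (simp add: moment_def)
qed

lemma moment_upper:
  assumes "r \<ge> -1"
  obtains K where "K > 0" "\<And>\<beta>. \<beta> > 0 \<Longrightarrow> moment r \<beta> \<le> K * \<beta> powr (-(d + r + 1))"
proof -
  obtain K where K: "K > 0"
    "\<And>b. b > 0 \<Longrightarrow> (\<lambda>k. real k powr (d + r) * exp (-(b * real k))) summable_on {1..}"
    "\<And>b. b > 0 \<Longrightarrow> (\<Sum>\<^sub>\<infinity>k\<in>{1..}. real k powr (d + r) * exp (-(b * real k))) \<le> K * b powr (-(d + r + 1))"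
    using sum_powr_exp_upper[of "d + r"] assms d_gt_1 by auto
  show ?thesis
  proof (rule that[of "c3 * K"])
    fix \<beta> :: real assume b: "\<beta> > 0"
    have "moment r \<beta> \<le> c3 * (\<Sum>\<^sub>\<infinity>k\<in>{1..}. real k powr (d + r) * exp (-(\<beta> * real k)))"
      by (rule has_sum_mono[OF moment_has_sum[OF assms b] has_sum_cmult_right[OF has_sum_infsum[OF K(2)[OF b]]]])
         (use moment_term_le in auto)
    also have "\<dots> \<le> c3 * (K * \<beta> powr (-(d + r + 1)))"
      using c3_pos K(3)[OF b] by (intro mult_left_mono) auto
    finally show "moment r \<beta> \<le> c3 * K * \<beta> powr (-(d + r + 1))" by (simp add: mult.assoc)
  qed (use c3_pos K in auto)
qed

lemma moment_lower:
  assumes "r \<ge> -1" "0 < \<beta>" "\<beta> \<le> B"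
  shows "c1 * exp (-2 * (1 + B)) * \<beta> powr (-(d + r + 1)) \<le> moment r \<beta>"
proof -
  obtain K where K:
    "\<And>b. b > 0 \<Longrightarrow> (\<lambda>k. real k powr (d + r) * exp (-(b * real k))) summable_on {1..}"
    using sum_powr_exp_upper[of "d + r"] assms d_gt_1 by auto
  note s = K[OF assms(2)]
  have "c1 * (exp (-2 * (1 + B)) * \<beta> powr (-(d + r + 1)))
      \<le> c1 * (\<Sum>\<^sub>\<infinity>k\<in>{1..}. real k powr (d + r) * exp (-(\<beta> * real k)))"
    using assms d_gt_1 c1_pos by (intro mult_left_mono sum_powr_exp_lower s) auto
  also have "\<dots> \<le> moment r \<beta>"
    by (rule has_sum_mono[OF has_sum_cmult_right[OF has_sum_infsum[OF s]] moment_has_sum[OF assms(1,2)]])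
       (use moment_term_ge in auto)
  finally show ?thesis by (simp add: mult.assoc)
qed

section \<open>Occupation numbers and Lambert series identities\<close>

lemma occupation_le:
  assumes "j \<ge> 1" "\<beta> > 0"
  shows "q j / (exp (\<beta> * real j) - 1) \<le> 2 * c2 / \<beta> * (real j powr (d - 2) * exp (-((\<beta> / 2) * real j)))"
proof -
  let ?y = "\<beta> * real j"
  have y: "?y > 0" using assms by simp
  then have pos: "?y / 2 * exp (?y / 2) > 0" by simp
  have "q j / (exp ?y - 1) \<le> (c2 * real j powr (d - 1)) / (?y / 2 * exp (?y / 2))"
    using exp_minus_one_ge[of ?y] y pos assms q_upper[of j] q_pos[of j]
    by (intro frac_le) auto
  also have "\<dots> = 2 * c2 / \<beta> * (real j powr (d - 1) / real j * exp (-(?y / 2)))"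
    using assms by (simp add: exp_minus field_simps)
  also have "real j powr (d - 1) / real j = real j powr (d - 2)"
    using assms powr_diff[of "real j" "d - 1" 1] by (simp add: algebra_simps)
  finally show ?thesis by (simp add: mult_ac)
qed

lemma occupation_nonneg: "j \<ge> 1 \<Longrightarrow> \<beta> > 0 \<Longrightarrow> q j / (exp (\<beta> * real j) - 1) \<ge> 0"
  using q_pos[of j] by simp

lemma occupation_summable:
  assumes "\<beta> > 0"
  shows "(\<lambda>j. q j / (exp (\<beta> * real j) - 1)) summable_on {1..}"
proof -
  obtain K where K:
    "\<And>b. b > 0 \<Longrightarrow> (\<lambda>k. real k powr (d - 2) * exp (-(b * real k))) summable_on {1..}"
    using sum_powr_exp_upper[of "d - 2"] d_gt_1 by auto
  show ?thesis
  proof (rule summable_on_comparison_test)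
    show "(\<lambda>j. 2 * c2 / \<beta> * (real j powr (d - 2) * exp (-((\<beta> / 2) * real j)))) summable_on {1..}"
      using assms by (intro summable_on_cmult_right K) auto
  qed (use occupation_le occupation_nonneg assms in auto)
qed

lemma occupation_sum_lower:
  assumes "0 < \<beta>" "\<beta> \<le> B"
  shows "c1 * exp (-2 * (1 + B)) * \<beta> powr (-d) \<le> (\<Sum>\<^sub>\<infinity>j\<in>{1..}. q j / (exp (\<beta> * real j) - 1))"
proof -
  obtain K where K:
    "\<And>b. b > 0 \<Longrightarrow> (\<lambda>k. real k powr (d - 1) * exp (-(b * real k))) summable_on {1..}"
    using sum_powr_exp_upper[of "d - 1"] d_gt_1 by auto
  have t: "(\<lambda>j. q j / (exp (\<beta> * real j) - 1)) summable_on {1..}"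
    using assms by (intro occupation_summable) auto
  note s = K[OF assms(1)]
  have "c1 * (exp (-2 * (1 + B)) * \<beta> powr (-(d - 1 + 1)))
      \<le> c1 * (\<Sum>\<^sub>\<infinity>k\<in>{1..}. real k powr (d - 1) * exp (-(\<beta> * real k)))"
    using assms d_gt_1 c1_pos by (intro mult_left_mono sum_powr_exp_lower s) auto
  also have "\<dots> \<le> (\<Sum>\<^sub>\<infinity>j\<in>{1..}. q j / (exp (\<beta> * real j) - 1))"
  proof (rule has_sum_mono[OF has_sum_cmult_right[OF has_sum_infsum[OF s]] has_sum_infsum[OF t]])
    fix j :: nat assume j: "j \<in> {1..}"
    have "c1 * (real j powr (d - 1) * exp (-(\<beta> * real j))) \<le> q j * exp (-(\<beta> * real j))"
      using q_lower[of j] j by (simp add: mult.assoc[symmetric])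
    also have "\<dots> \<le> q j / (exp (\<beta> * real j) - 1)"
    proof -
      have "inverse (exp (\<beta> * real j)) \<le> inverse (exp (\<beta> * real j) - 1)"
        using assms j by (intro le_imp_inverse_le) auto
      then show ?thesis
        using q_pos[of j] j by (simp add: exp_minus divide_inverse)
    qed
    finally show "c1 * (real j powr (d - 1) * exp (-(\<beta> * real j))) \<le> q j / (exp (\<beta> * real j) - 1)" .
  qed
  finally show ?thesis by (simp add: mult.assoc)
qed

text \<open>Expand the logarithm as the series of \<open>exp (-(\<beta> * j * l)) / l\<close> and
  regroup by \<open>k = j * l\<close>; the factor \<open>1 / l = j / k\<close> supplies the
  \<open>j\<close> in \<open>div_sum\<close>.\<close>

lemma log_partition_has_sum:
  assumes "\<beta> > 0"
  shows "((\<lambda>j. - q j * ln (1 - exp (-(\<beta> * real j)))) has_sum moment (-1) \<beta>) {1..}"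
proof -
  note t = occupation_summable[OF assms]
  have s: "(\<lambda>j. - q j * ln (1 - exp (-(\<beta> * real j)))) summable_on {1..}"
  proof (rule summable_on_comparison_test[OF t])
    fix j :: nat assume j: "j \<in> {1..}"
    let ?y = "\<beta> * real j"
    have y: "?y > 0" using assms j by simp
    have "q j * (- ln (1 - exp (-?y))) \<le> q j * (1 / (exp ?y - 1))"
      using q_pos[of j] j minus_ln_one_minus_exp_le[OF y] by (intro mult_left_mono) auto
    then show "- q j * ln (1 - exp (-?y)) \<le> q j / (exp ?y - 1)" by simp
    have "ln (1 - exp (-?y)) \<le> 0" using y by simp
    then show "0 \<le> - q j * ln (1 - exp (-?y))" using q_pos[of j] j by (simp add: mult_nonneg_nonpos)
  qed
  have "((\<lambda>k. \<Sum>j | j dvd k. q j * (real j * exp (-(\<beta> * real k)) / real k))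
     has_sum (\<Sum>\<^sub>\<infinity>j\<in>{1..}. - q j * ln (1 - exp (-(\<beta> * real j))))) {1..}"
  proof (rule has_sum_divisor_regroup[OF _ _ has_sum_infsum[OF s]])
    fix j k :: nat assume "j \<ge> 1" "k \<ge> 1"
    then show "q j * (real j * exp (-(\<beta> * real k)) / real k) \<ge> 0" using q_pos[of j] by simp
  next
    fix j :: nat assume j: "j \<ge> 1"
    then have y: "\<beta> * real j > 0" using assms by simp
    have "((\<lambda>l. q j * (exp (-(\<beta> * real j * real l)) / real l)) has_sum
        (q j * - ln (1 - exp (-(\<beta> * real j))))) {1..}"
      by (rule has_sum_cmult_right[OF has_sum_ln_one_minus[OF y]])
    also have "?this \<longleftrightarrow> ((\<lambda>l. q j * (real j * exp (-(\<beta> * real (j * l))) / real (j * l))) has_sum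
        (- q j * ln (1 - exp (-(\<beta> * real j))))) {1..}"
      using j by (intro has_sum_cong arg_cong2[where f = "\<lambda>f x. (f has_sum x) {1..}"]) (auto simp: mult.assoc)
    finally show "((\<lambda>l. q j * (real j * exp (-(\<beta> * real (j * l))) / real (j * l))) has_sum
        (- q j * ln (1 - exp (-(\<beta> * real j))))) {1..}" .
  qed
  also have "?this \<longleftrightarrow> ((\<lambda>k. real k powr (-1) * div_sum q k * exp (-(\<beta> * real k))) has_sum
      (\<Sum>\<^sub>\<infinity>j\<in>{1..}. - q j * ln (1 - exp (-(\<beta> * real j))))) {1..}"
    by (intro has_sum_cong)
       (auto simp: div_sum_def powr_minus sum_distrib_left sum_distrib_right field_simps intro!: sum.cong)
  finally have "(\<Sum>\<^sub>\<infinity>j\<in>{1..}. - q j * ln (1 - exp (-(\<beta> * real j)))) = moment (-1) \<beta>"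
    by (rule has_sum_unique[OF _ moment_has_sum]) (use assms in auto)
  with has_sum_infsum[OF s] show ?thesis by simp
qed

text \<open>Geometric expansion of \<open>1 / (exp y - 1)\<close>, regrouped by divisors. It turns
  the equation that defines \<open>b_sol\<close> into \<open>moment 0 \<beta> = M\<close>.\<close>

lemma energy_has_sum:
  assumes "\<beta> > 0"
  shows "((\<lambda>j. real j * q j / (exp (\<beta> * real j) - 1)) has_sum moment 0 \<beta>) {1..}"
proof -
  obtain K where K:
    "\<And>b. b > 0 \<Longrightarrow> (\<lambda>k. real k powr (d - 1) * exp (-(b * real k))) summable_on {1..}"
    using sum_powr_exp_upper[of "d - 1"] d_gt_1 by auto
  have s: "(\<lambda>j. real j * q j / (exp (\<beta> * real j) - 1)) summable_on {1..}"
  proof (rule summable_on_comparison_test)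
    show "(\<lambda>j. 2 * c2 / \<beta> * (real j powr (d - 1) * exp (-((\<beta> / 2) * real j)))) summable_on {1..}"
      using assms by (intro summable_on_cmult_right K) auto
    fix j :: nat assume j: "j \<in> {1..}"
    then have "real j * (q j / (exp (\<beta> * real j) - 1))
      \<le> real j * (2 * c2 / \<beta> * (real j powr (d - 2) * exp (-((\<beta> / 2) * real j))))"
      using assms by (intro mult_left_mono occupation_le) auto
    also have "\<dots> = 2 * c2 / \<beta> * (real j * real j powr (d - 2) * exp (-((\<beta> / 2) * real j)))"
      by simp
    also have "real j * real j powr (d - 2) = real j powr (d - 1)"
      using j powr_add[of "real j" 1 "d - 2"] by simp
    finally show "real j * q j / (exp (\<beta> * real j) - 1)
      \<le> 2 * c2 / \<beta> * (real j powr (d - 1) * exp (-((\<beta> / 2) * real j)))" by simp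
    show "0 \<le> real j * q j / (exp (\<beta> * real j) - 1)"
      using assms j q_pos[of j] by simp
  qed
  have "((\<lambda>k. \<Sum>j | j dvd k. real j * q j * exp (-(\<beta> * real k)))
     has_sum (\<Sum>\<^sub>\<infinity>j\<in>{1..}. real j * q j / (exp (\<beta> * real j) - 1))) {1..}"
  proof (rule has_sum_divisor_regroup[OF _ _ has_sum_infsum[OF s]])
    fix j k :: nat assume "j \<ge> 1" "k \<ge> 1"
    then show "real j * q j * exp (-(\<beta> * real k)) \<ge> 0" using q_pos[of j] by simp
  next
    fix j :: nat assume j: "j \<ge> 1"
    then have y: "\<beta> * real j > 0" using assms by simp
    have "((\<lambda>l. real j * q j * exp (-(\<beta> * real j * real l))) has_sum
        (real j * q j * (1 / (exp (\<beta> * real j) - 1)))) {1..}"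
      by (rule has_sum_cmult_right[OF has_sum_exp[OF y]])
    then show "((\<lambda>l. real j * q j * exp (-(\<beta> * real (j * l)))) has_sum
        (real j * q j / (exp (\<beta> * real j) - 1))) {1..}"
      by (simp add: mult.assoc)
  qed
  also have "?this \<longleftrightarrow> ((\<lambda>k. real k powr 0 * div_sum q k * exp (-(\<beta> * real k))) has_sum
      (\<Sum>\<^sub>\<infinity>j\<in>{1..}. real j * q j / (exp (\<beta> * real j) - 1))) {1..}"
    by (intro has_sum_cong) (auto simp: div_sum_def sum_distrib_right)
  finally have "(\<Sum>\<^sub>\<infinity>j\<in>{1..}. real j * q j / (exp (\<beta> * real j) - 1)) = moment 0 \<beta>"
    by (rule has_sum_unique[OF _ moment_has_sum]) (use assms in auto)
  with has_sum_infsum[OF s] show ?thesis by simp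
qed

end

section \<open>The Legendre transform of the log-partition function\<close>

text \<open>Multiplied by \<open>exp y\<close>, the difference of the two sides vanishes at 0 and
  has derivative \<open>y * (exp y - 1)\<close>.\<close>

lemma exp_remainder_quadratic:
  fixes y :: real
  assumes "y \<ge> 0"
  shows "y\<^sup>2 / 2 * exp (-y) \<le> exp (-y) - 1 + y"
proof -
  let ?h = "\<lambda>y::real. 1 + (y - 1) * exp y - y\<^sup>2 / 2"
  have "?h 0 \<le> ?h y"
  proof (rule DERIV_nonneg_imp_nondecreasing[OF assms])
    fix x :: real assume x: "0 \<le> x" "x \<le> y"
    have "(?h has_real_derivative x * (exp x - 1)) (at x)"
      by (auto intro!: derivative_eq_intros simp: algebra_simps power2_eq_square)
    moreover have "x * (exp x - 1) \<ge> 0" using x by simp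
    ultimately show "\<exists>z. (?h has_real_derivative z) (at x) \<and> 0 \<le> z" by blast
  qed
  then have "0 \<le> exp (-y) * (1 + (y - 1) * exp y - y\<^sup>2 / 2)" by simp
  also have "\<dots> = exp (-y) - 1 + y - y\<^sup>2 / 2 * exp (-y)"
    by (simp add: algebra_simps exp_minus)
  finally show ?thesis by simp
qed

text \<open>Convexity of \<open>exp (-y) - 1 + y\<close> together with its value 0 at the origin;
  two uses of \<open>1 + z \<le> exp z\<close> stand in for derivatives.\<close>

lemma exp_remainder_superlinear:
  fixes y c :: real
  assumes "y \<ge> 0" "c \<ge> 1"
  shows "c * (exp (-y) - 1 + y) \<le> exp (-(c * y)) - 1 + c * y"
proof -
  have "exp (-y) * (1 - (c - 1) * y) \<le> exp (-y) * exp (-((c - 1) * y))"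
    using exp_ge_add_one_self[of "-((c - 1) * y)"] by (intro mult_left_mono) auto
  also have "\<dots> = exp (-(c * y))" by (simp add: exp_add[symmetric] algebra_simps)
  finally have 1: "exp (-y) * (1 - (c - 1) * y) \<le> exp (-(c * y))" .
  have "exp (-y) * (1 + y) \<le> exp (-y) * exp y"
    using exp_ge_add_one_self[of y] by (intro mult_left_mono) auto
  then have "exp (-y) * (1 + y) \<le> 1" by (simp add: exp_add[symmetric])
  then have "(c - 1) * (exp (-y) * (1 + y)) \<le> (c - 1) * 1"
    using assms by (intro mult_left_mono) auto
  with 1 show ?thesis by (simp add: algebra_simps)
qed

context boson_gas
begin

section \<open>Existence and uniqueness of b\<close>

lemma moment_0_strict_antimono:
  assumes "0 < \<beta>" "\<beta> < \<beta>'"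
  shows "moment 0 \<beta>' < moment 0 \<beta>"
proof (rule has_sum_strict_mono[OF moment_has_sum moment_has_sum, where x = 1])
  show "real 1 powr 0 * div_sum q 1 * exp (- (\<beta>' * real 1)) < real 1 powr 0 * div_sum q 1 * exp (- (\<beta> * real 1))"
    using div_sum_lower[of 1] c1_pos assms by simp
qed (use assms in \<open>auto intro!: mult_left_mono mult_right_mono div_sum_nonneg\<close>)

text \<open>\<open>moment 0\<close> is a power series in \<open>exp (-\<beta>)\<close>. It converges
  at \<open>exp (-(\<beta> / 2))\<close>, so \<open>exp (-\<beta>)\<close> lies strictly inside the
  disc of convergence.\<close>

lemma isCont_moment_0:
  assumes "\<beta> > 0"
  shows "isCont (moment 0) \<beta>"
proof -
  have sums: "(\<lambda>n. div_sum q n * exp (-x) ^ n) sums moment 0 x" if "x > 0" for x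
  proof -
    have "((\<lambda>k. real k powr 0 * div_sum q k * exp (-(x * real k))) has_sum moment 0 x) {1..}"
      using that by (intro moment_has_sum) auto
    also have "?this \<longleftrightarrow> ((\<lambda>n. div_sum q n * exp (-x) ^ n) has_sum moment 0 x) UNIV"
      by (rule has_sum_cong_neutral) (auto simp: exp_of_nat_mult[symmetric] mult.commute not_le)
    finally show ?thesis by (rule has_sum_imp_sums)
  qed
  have c: "isCont (\<lambda>z. \<Sum>n. div_sum q n * z ^ n) (exp (-\<beta>))"
    by (rule isCont_powser[where K = "exp (-(\<beta> / 2))"])
       (use sums_summable[OF sums[of "\<beta> / 2"]] assms in auto)
  have "isCont (\<lambda>x. exp (-x)) \<beta>" by (intro continuous_intros)
  from isCont_o2[OF this c] have "isCont (\<lambda>x. \<Sum>n. div_sum q n * exp (-x) ^ n) \<beta>" .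
  moreover have "\<forall>\<^sub>F x in nhds \<beta>. (\<Sum>n. div_sum q n * exp (-x) ^ n) = moment 0 x"
  proof -
    have "\<forall>\<^sub>F x in nhds \<beta>. x \<in> {0<..}" using assms by (intro eventually_nhds_in_open) auto
    then show ?thesis by eventually_elim (rule sums_unique[symmetric], rule sums, simp)
  qed
  ultimately show ?thesis by (simp add: isCont_cong)
qed

text \<open>Intermediate values between \<open>s \<le> 1\<close> and \<open>l \<ge> 1\<close>. On
  either side of 1 the exponent \<open>-(d + 1)\<close> can be weakened to \<open>-1\<close>, which
  makes explicit endpoints easy.\<close>

lemma moment_0_surj:
  assumes "m > 0"
  obtains \<beta> where "\<beta> > 0" "moment 0 \<beta> = m"
proof -
  obtain K where K: "K > 0" "\<And>\<beta>. \<beta> > 0 \<Longrightarrow> moment 0 \<beta> \<le> K * \<beta> powr (-(d + 1))"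
    using moment_upper[of 0] by auto
  define k where "k = c1 * exp (-4)"
  have k: "k > 0" "\<And>\<beta>. 0 < \<beta> \<Longrightarrow> \<beta> \<le> 1 \<Longrightarrow> k * \<beta> powr (-(d + 1)) \<le> moment 0 \<beta>"
    using moment_lower[of 0 _ 1] c1_pos by (auto simp: k_def)
  define s where "s = min 1 (k / m)"
  define l where "l = max 1 (K / m)"
  have s: "s > 0" "s \<le> 1" "s \<le> k / m" using k assms by (auto simp: s_def)
  have l: "l \<ge> 1" "l \<ge> K / m" by (auto simp: l_def)
  have inv: "x powr (-1) = 1 / x" if "x > 0" for x :: real
    using that by (simp add: powr_minus divide_inverse)
  have "m \<le> k * (1 / s)" using s assms k by (simp add: field_simps)
  also have "\<dots> \<le> k * s powr (-(d + 1))"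
    unfolding inv[OF s(1), symmetric]
    using s d_gt_1 k powr_mono'[of "-(d + 1)" "-1" s] by (intro mult_left_mono) auto
  also have "\<dots> \<le> moment 0 s" using s by (intro k)
  finally have 1: "m \<le> moment 0 s" .
  have "moment 0 l \<le> K * l powr (-(d + 1))" using l by (intro K) auto
  also have "\<dots> \<le> K * l powr (-1)"
    using l K d_gt_1 by (intro mult_left_mono powr_mono) auto
  also have "\<dots> \<le> m" using l assms by (subst inv) (auto simp: field_simps)
  finally have 2: "moment 0 l \<le> m" .
  have "\<exists>x\<ge>s. x \<le> l \<and> moment 0 x = m"
    by (rule IVT2) (use 1 2 s l isCont_moment_0 in auto)
  then obtain x where "s \<le> x" "moment 0 x = m" by blast
  then show ?thesis using s by (intro that) auto
qed

lemma b_sol: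
  assumes "M \<ge> 1"
  shows b_sol_pos: "b_sol q M > 0" and moment_b_sol: "moment 0 (b_sol q M) = real M"
proof -
  define P where "P \<beta> \<longleftrightarrow> \<beta> > 0 \<and> ((\<lambda>j. real j * q j / (exp (\<beta> * real j) - 1)) has_sum real M) {1..}" for \<beta>
  have P: "P \<beta> \<longleftrightarrow> \<beta> > 0 \<and> moment 0 \<beta> = real M" for \<beta>
    unfolding P_def using energy_has_sum[of \<beta>] has_sum_unique by metis
  obtain \<beta> where b: "\<beta> > 0" "moment 0 \<beta> = real M"
    using moment_0_surj[of "real M"] assms by auto
  have "P (b_sol q M)"
    unfolding b_sol_def P_def[symmetric]
  proof (rule theI)
    show "P \<beta>" using P b by blast
    fix x assume "P x"
    then have "x > 0" "moment 0 x = moment 0 \<beta>" using P b by auto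
    then show "x = \<beta>"
      using moment_0_strict_antimono[of x \<beta>] moment_0_strict_antimono[of \<beta> x] b
      by (cases x \<beta> rule: linorder_cases) auto
  qed
  then show "b_sol q M > 0" "moment 0 (b_sol q M) = real M" using P by auto
qed

text \<open>The distance at \<open>\<beta> + x\<close> between the convex function \<open>moment (-1)\<close> and its tangent at \<open>\<beta>\<close>.\<close>

definition gap :: "real \<Rightarrow> real \<Rightarrow> real" where
  "gap \<beta> x = moment (-1) (\<beta> + x) - moment (-1) \<beta> + x * moment 0 \<beta>"

lemma gap_has_sum:
  assumes "\<beta> > 0" "\<beta> + x > 0"
  shows "((\<lambda>k. real k powr (-1) * div_sum q k * exp (-(\<beta> * real k))
    * (exp (-(x * real k)) - 1 + x * real k)) has_sum gap \<beta> x) {1..}"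
proof -
  have "((\<lambda>k. real k powr (-1) * div_sum q k * exp (-((\<beta> + x) * real k))
      + (-1) * (real k powr (-1) * div_sum q k * exp (-(\<beta> * real k)))
      + x * (real k powr 0 * div_sum q k * exp (-(\<beta> * real k))))
    has_sum (moment (-1) (\<beta> + x) + (-1) * moment (-1) \<beta> + x * moment 0 \<beta>)) {1..}"
    using assms by (intro has_sum_add has_sum_cmult_right moment_has_sum) auto
  also have "moment (-1) (\<beta> + x) + (-1) * moment (-1) \<beta> + x * moment 0 \<beta> = gap \<beta> x"
    by (simp add: gap_def)
  also have "((\<lambda>k. real k powr (-1) * div_sum q k * exp (-((\<beta> + x) * real k))
      + (-1) * (real k powr (-1) * div_sum q k * exp (-(\<beta> * real k)))
      + x * (real k powr 0 * div_sum q k * exp (-(\<beta> * real k)))) has_sum gap \<beta> x) {1..} \<longleftrightarrow> ?thesis"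
  proof (rule has_sum_cong)
    fix k :: nat assume "k \<in> {1..}"
    then have k: "real k > 0" by simp
    have e: "exp (-((\<beta> + x) * real k)) = exp (-(\<beta> * real k)) * exp (-(x * real k))"
      by (simp add: exp_add[symmetric] algebra_simps)
    show "real k powr (-1) * div_sum q k * exp (-((\<beta> + x) * real k))
      + (-1) * (real k powr (-1) * div_sum q k * exp (-(\<beta> * real k)))
      + x * (real k powr 0 * div_sum q k * exp (-(\<beta> * real k)))
      = real k powr (-1) * div_sum q k * exp (-(\<beta> * real k)) * (exp (-(x * real k)) - 1 + x * real k)"
      unfolding e using k by (simp add: powr_minus_divide field_simps)
  qed
  finally show ?thesis .
qed

text \<open>For \<open>x \<le> \<beta>\<close> the factor \<open>exp (-(x * k))\<close> in the
  quadratic remainder bound is at least \<open>exp (-(\<beta> * k))\<close>, which leaves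
  \<open>moment 1\<close> at \<open>2 * \<beta>\<close>. Beyond \<open>\<beta>\<close>,
  superlinearity extends the value at \<open>x = \<beta>\<close> linearly.\<close>

lemma gap_bounds:
  assumes "B > 0"
  obtains k where "k > 0"
    "\<And>\<beta> x. 0 < \<beta> \<Longrightarrow> 0 < \<beta> + x \<Longrightarrow> 0 \<le> gap \<beta> x"
    "\<And>\<beta> x. 0 < \<beta> \<Longrightarrow> \<beta> \<le> B \<Longrightarrow> 0 \<le> x \<Longrightarrow> x \<le> \<beta> \<Longrightarrow>
      k * x\<^sup>2 * \<beta> powr (-(d + 2)) \<le> gap \<beta> x"
    "\<And>\<beta> x. 0 < \<beta> \<Longrightarrow> \<beta> \<le> B \<Longrightarrow> \<beta> \<le> x \<Longrightarrow>
      k * x * \<beta> powr (-(d + 1)) \<le> gap \<beta> x"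
proof -
  let ?h = "\<lambda>y::real. exp (-y) - 1 + y"
  \<comment> \<open>The constant of \<open>moment_lower\<close> for arguments up to
    \<open>2 * B\<close>, with \<open>2 powr (-(d + 2))\<close> from the argument
    \<open>2 * \<beta>\<close> and \<open>1 / 2\<close> from the remainder bound.\<close>
  define k where "k = c1 * exp (-2 * (1 + 2 * B)) * 2 powr (-(d + 2)) / 2"
  have k: "k > 0" using c1_pos by (simp add: k_def)
  have nonneg: "0 \<le> gap \<beta> x" if "0 < \<beta>" "0 < \<beta> + x" for \<beta> x
  proof (rule has_sum_nonneg[OF gap_has_sum[OF that]])
    fix k :: nat
    have "?h (x * real k) \<ge> 0" using exp_ge_add_one_self[of "-(x * real k)"] by linarith
    then show "0 \<le> real k powr (-1) * div_sum q k * exp (-(\<beta> * real k)) * ?h (x * real k)"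
      by simp
  qed
  have quad: "k * x\<^sup>2 * \<beta> powr (-(d + 2)) \<le> gap \<beta> x" if b: "0 < \<beta>" "\<beta> \<le> B" and x: "0 \<le> x" "x \<le> \<beta>" for \<beta> x
  proof -
    have "k * x\<^sup>2 * \<beta> powr (-(d + 2))
        = x\<^sup>2 / 2 * (c1 * exp (-2 * (1 + 2 * B)) * (2 * \<beta>) powr (-(d + 2)))"
      using b by (simp only: k_def powr_mult) simp
    also have "\<dots> \<le> x\<^sup>2 / 2 * moment 1 (2 * \<beta>)"
      using moment_lower[of 1 "2 * \<beta>" "2 * B"] b by (intro mult_left_mono) (auto simp: add.assoc)
    also have "\<dots> \<le> gap \<beta> x"
    proof (rule has_sum_mono[OF has_sum_cmult_right[OF moment_has_sum] gap_has_sum])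
      fix k :: nat assume "k \<in> {1..}"
      then have k: "real k > 0" by simp
      have "exp (-(2 * \<beta> * real k)) \<le> exp (-(\<beta> * real k)) * exp (-(x * real k))"
        using x k by (simp add: exp_add[symmetric] distrib_right[symmetric])
      then have "real k powr (-1) * div_sum q k * ((x * real k)\<^sup>2 / 2) * exp (-(2 * \<beta> * real k))
          \<le> real k powr (-1) * div_sum q k * ((x * real k)\<^sup>2 / 2) * (exp (-(\<beta> * real k)) * exp (-(x * real k)))"
        by (intro mult_left_mono) auto
      also have "\<dots> = real k powr (-1) * div_sum q k * exp (-(\<beta> * real k)) * ((x * real k)\<^sup>2 / 2 * exp (-(x * real k)))"
        by simp
      also have "\<dots> \<le> real k powr (-1) * div_sum q k * exp (-(\<beta> * real k)) * ?h (x * real k)"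
        using x k by (intro mult_left_mono exp_remainder_quadratic) auto
      also have "real k powr (-1) * div_sum q k * ((x * real k)\<^sup>2 / 2) * exp (-(2 * \<beta> * real k))
          = x\<^sup>2 / 2 * (real k powr 1 * div_sum q k * exp (-(2 * \<beta> * real k)))"
        using k by (simp add: powr_minus power2_eq_square field_simps)
      finally show "x\<^sup>2 / 2 * (real k powr 1 * div_sum q k * exp (-(2 * \<beta> * real k)))
        \<le> real k powr (-1) * div_sum q k * exp (-(\<beta> * real k)) * ?h (x * real k)" .
    qed (use b x in auto)
    finally show ?thesis .
  qed
  have "k * x * \<beta> powr (-(d + 1)) \<le> gap \<beta> x" if b: "0 < \<beta>" "\<beta> \<le> B" and x: "\<beta> \<le> x" for \<beta> x
  proof -
    have p: "\<beta> * \<beta> powr (-(d + 2)) = \<beta> powr (-(d + 1))"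
      using b powr_add[of \<beta> 1 "-(d + 2)"] by (simp add: algebra_simps)
    have "k * x * \<beta> powr (-(d + 1)) = (x / \<beta>) * (k * \<beta>\<^sup>2 * \<beta> powr (-(d + 2)))"
      unfolding p[symmetric] using b by (simp add: power2_eq_square)
    also have "\<dots> \<le> (x / \<beta>) * gap \<beta> \<beta>"
      using b x by (intro mult_left_mono quad) auto
    also have "\<dots> \<le> gap \<beta> x"
    proof (rule has_sum_mono[OF has_sum_cmult_right[OF gap_has_sum] gap_has_sum])
      fix k :: nat assume "k \<in> {1..}"
      have "(x / \<beta>) * ?h (\<beta> * real k) \<le> ?h ((x / \<beta>) * (\<beta> * real k))"
        using b x by (intro exp_remainder_superlinear) auto
      also have "(x / \<beta>) * (\<beta> * real k) = x * real k" using b by simp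
      finally have "real k powr (-1) * div_sum q k * exp (-(\<beta> * real k)) * ((x / \<beta>) * ?h (\<beta> * real k))
          \<le> real k powr (-1) * div_sum q k * exp (-(\<beta> * real k)) * ?h (x * real k)"
        by (intro mult_left_mono) auto
      then show "(x / \<beta>) * (real k powr (-1) * div_sum q k * exp (-(\<beta> * real k)) * ?h (\<beta> * real k))
          \<le> real k powr (-1) * div_sum q k * exp (-(\<beta> * real k)) * ?h (x * real k)"
        by (simp only: mult_ac)
    qed (use b x in auto)
    finally show ?thesis .
  qed
  from that[OF k nonneg quad this] show ?thesis .
qed

text \<open>Quantitative concavity of the Legendre transform: the bound holds at every
  \<open>\<beta>'\<close>, hence at the minimiser for energy \<open>moment 0 \<beta> - k\<close>.
  With \<open>x = \<beta>' - \<beta>\<close> it says that \<open>gap \<beta> x\<close> is at least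
  \<open>x * k\<close> minus the quadratic loss. The range of \<open>k\<close> is what the linear
  regime \<open>x \<ge> \<beta>\<close> can absorb.\<close>

lemma legendre_lower:
  assumes "B > 0"
  obtains \<kappa> where "\<kappa> > 0"
    "\<And>\<beta> \<beta>' k. 0 < \<beta> \<Longrightarrow> \<beta> \<le> B \<Longrightarrow> 0 < \<beta>' \<Longrightarrow> 0 \<le> k \<Longrightarrow> k \<le> \<kappa> * \<beta> powr (-(d + 1)) \<Longrightarrow>
      moment (-1) \<beta> + \<beta> * (moment 0 \<beta> - k) - k\<^sup>2 * \<beta> powr (d + 2) / (4 * \<kappa>)
        \<le> moment (-1) \<beta>' + \<beta>' * (moment 0 \<beta> - k)"
proof -
  obtain \<kappa> where kap: "\<kappa> > 0"
    "\<And>\<beta> x. 0 < \<beta> \<Longrightarrow> 0 < \<beta> + x \<Longrightarrow> 0 \<le> gap \<beta> x"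
    "\<And>\<beta> x. 0 < \<beta> \<Longrightarrow> \<beta> \<le> B \<Longrightarrow> 0 \<le> x \<Longrightarrow> x \<le> \<beta> \<Longrightarrow> \<kappa> * x\<^sup>2 * \<beta> powr (-(d + 2)) \<le> gap \<beta> x"
    "\<And>\<beta> x. 0 < \<beta> \<Longrightarrow> \<beta> \<le> B \<Longrightarrow> \<beta> \<le> x \<Longrightarrow> \<kappa> * x * \<beta> powr (-(d + 1)) \<le> gap \<beta> x"
    by (rule gap_bounds[OF assms]) blast
  show ?thesis
  proof (rule that[OF kap(1)])
    fix \<beta> \<beta>' k :: real
    assume b: "0 < \<beta>" "\<beta> \<le> B" "0 < \<beta>'" and k: "0 \<le> k" "k \<le> \<kappa> * \<beta> powr (-(d + 1))"
    define x where "x = \<beta>' - \<beta>"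
    define t where "t = \<beta> powr (d + 2)"
    have t: "t > 0" using b by (simp add: t_def)
    have tinv: "\<beta> powr (-(d + 2)) = 1 / t" using b by (simp only: t_def powr_minus_divide)
    have nn: "0 \<le> k\<^sup>2 * t / (4 * \<kappa>)" using kap t by simp
    have "x * k - k\<^sup>2 * t / (4 * \<kappa>) \<le> gap \<beta> x"
    proof -
      consider "x < 0" | "0 \<le> x" "x \<le> \<beta>" | "\<beta> \<le> x" by linarith
      then show ?thesis
      proof cases
        case 1
        then have "x * k \<le> 0" using k by (simp add: mult_nonpos_nonneg)
        with kap(2)[of \<beta> x] b nn show ?thesis by (simp add: x_def)
      next
        case 2
        \<comment> \<open>Completing the square: over all \<open>x\<close>,
          \<open>x * k - \<kappa> * x\<^sup>2 / t\<close> is at most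
          \<open>k\<^sup>2 * t / (4 * \<kappa>)\<close>.\<close>
        have "0 \<le> (2 * \<kappa> * x - k * t)\<^sup>2 / (4 * \<kappa> * t)" using kap t by simp
        also have "\<dots> = \<kappa> * x\<^sup>2 * (1 / t) - x * k + k\<^sup>2 * t / (4 * \<kappa>)"
          using kap t by (simp add: field_simps power2_eq_square)
        finally show ?thesis using kap(3)[OF b(1,2) 2] unfolding tinv by linarith
      next
        case 3
        have "x * k \<le> x * (\<kappa> * \<beta> powr (-(d + 1)))" using 3 b k by (intro mult_left_mono) auto
        also have "\<dots> \<le> gap \<beta> x" using kap(4)[OF b(1,2) 3] by (simp add: mult_ac)
        finally show ?thesis using nn by linarith
      qed
    qed
    then show "moment (-1) \<beta> + \<beta> * (moment 0 \<beta> - k) - k\<^sup>2 * \<beta> powr (d + 2) / (4 * \<kappa>)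
        \<le> moment (-1) \<beta>' + \<beta>' * (moment 0 \<beta> - k)"
      by (simp add: gap_def x_def t_def algebra_simps)
  qed
qed

section \<open>Lower bound for the total weight\<close>

text \<open>\<open>G(M)\<close> of the overview, given by its value at the stationary point instead
  of as a minimum.\<close>

definition entropy :: "nat \<Rightarrow> real" where
  "entropy M = moment (-1) (b_sol q M) + b_sol q M * real M"

text \<open>\<open>moment 0\<close> decays like \<open>\<beta> powr (-(d + 1))\<close>, so energy at
  least 1 bounds \<beta>. This supplies the bound \<open>B\<close> on which the constants of
  \<open>moment_lower\<close> and \<open>legendre_lower\<close> depend.\<close>

lemma b_sol_bounded:
  obtains B where "B > 0" "\<And>M. M \<ge> 1 \<Longrightarrow> b_sol q M \<le> B"
proof -
  obtain K where K: "K > 0" "\<And>\<beta>. \<beta> > 0 \<Longrightarrow> moment 0 \<beta> \<le> K * \<beta> powr (-(d + 0 + 1))"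
    by (rule moment_upper[of 0]) auto
  show ?thesis
  proof (rule that)
    fix M :: nat assume M: "M \<ge> 1"
    let ?b = "b_sol q M"
    have b: "?b > 0" using b_sol_pos M by simp
    have "1 \<le> real M" using M by simp
    also have "\<dots> \<le> K * ?b powr (-(d + 1))" using K(2)[OF b] moment_b_sol[OF M] by simp
    finally have "?b powr (d + 1) \<le> K"
      using b unfolding powr_minus_divide by simp
    then have "(?b powr (d + 1)) powr (1 / (d + 1)) \<le> K powr (1 / (d + 1))"
      using d_gt_1 by (intro powr_mono2) auto
    then show "?b \<le> K powr (1 / (d + 1))" using b d_gt_1 by (simp add: powr_powr)
  qed (use K in simp)
qed

text \<open>The mean, over the weights \<open>div_sum q k * exp (-(\<beta> * k))\<close>, of the
  quadratic polynomial that bounds gain and loss in the induction step.\<close>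

lemma moment_combination_has_sum:
  assumes "\<beta> > 0"
  shows "((\<lambda>k. h * (div_sum q k * exp (-(\<beta> * real k)) * (1 + u * real k - v * (real k)\<^sup>2)))
    has_sum (h * (moment 0 \<beta> + u * moment 1 \<beta> - v * moment 2 \<beta>))) {1..}"
proof -
  have "((\<lambda>k. h * (real k powr 0 * div_sum q k * exp (-(\<beta> * real k))
      + u * (real k powr 1 * div_sum q k * exp (-(\<beta> * real k)))
      + (-v) * (real k powr 2 * div_sum q k * exp (-(\<beta> * real k)))))
    has_sum (h * (moment 0 \<beta> + u * moment 1 \<beta> + (-v) * moment 2 \<beta>))) {1..}"
    using assms by (intro has_sum_add has_sum_cmult_right moment_has_sum) auto
  also have "?this \<longleftrightarrow> ((\<lambda>k. h * (div_sum q k * exp (-(\<beta> * real k)) * (1 + u * real k - v * (real k)\<^sup>2)))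
    has_sum (h * (moment 0 \<beta> + u * moment 1 \<beta> + (-v) * moment 2 \<beta>))) {1..}"
    by (rule has_sum_cong) (auto simp: algebra_simps)
  finally show ?thesis by simp
qed

lemma total_weight_Omega_lower:
  obtains A c where "A \<ge> 0" "c > 0"
    "\<And>M. M \<ge> 1 \<Longrightarrow> c * real M powr (-A) * exp (entropy M) \<le> total_weight q (Omega M)"
proof -
  let ?W = "\<lambda>M. total_weight q (Omega M)" and ?b = "b_sol q"
  obtain B where B: "B > 0" "\<And>M. M \<ge> 1 \<Longrightarrow> ?b M \<le> B" by (rule b_sol_bounded) blast
  obtain \<kappa> where kap: "\<kappa> > 0"
    "\<And>\<beta> \<beta>' k. 0 < \<beta> \<Longrightarrow> \<beta> \<le> B \<Longrightarrow> 0 < \<beta>' \<Longrightarrow> 0 \<le> k \<Longrightarrow> k \<le> \<kappa> * \<beta> powr (-(d + 1)) \<Longrightarrow>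
      moment (-1) \<beta> + \<beta> * (moment 0 \<beta> - k) - k\<^sup>2 * \<beta> powr (d + 2) / (4 * \<kappa>)
        \<le> moment (-1) \<beta>' + \<beta>' * (moment 0 \<beta> - k)"
    by (rule legendre_lower[OF B(1)]) blast
  define k0 where "k0 = c1 * exp (-2 * (1 + B))"
  have k0: "k0 > 0" using c1_pos by (simp add: k0_def)
  have low: "k0 * \<beta> powr (-(d + r + 1)) \<le> moment r \<beta>" if "r \<ge> -1" "0 < \<beta>" "\<beta> \<le> B" for r \<beta>
    using moment_lower[OF that] by (simp add: k0_def)
  obtain k2 where k2: "k2 > 0" "\<And>\<beta>. \<beta> > 0 \<Longrightarrow> moment 2 \<beta> \<le> k2 * \<beta> powr (-(d + 2 + 1))"
    by (rule moment_upper[of 2]) auto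
  obtain k4 where k4: "k4 > 0" "\<And>\<beta>. \<beta> > 0 \<Longrightarrow> moment 0 \<beta> \<le> k4 * \<beta> powr (-(d + 0 + 1))"
    by (rule moment_upper[of 0]) auto
  define C where "C = 1 / (4 * \<kappa>)"
  define A where "A = C * k2 * k4 / k0"
  \<comment> \<open>\<open>\<delta> \<le> \<kappa>\<close> gives access to the concavity bound and
    \<open>\<delta> \<le> k0 / 2\<close> keeps \<open>k \<le> M / 2\<close> in the good range.
    \<open>E\<close> bounds \<open>1 + A * k / M\<close> by a multiple of
    \<open>(k * u)\<^sup>2\<close> outside it, where \<open>u = b powr (d + 1)\<close>;
    \<open>b0\<close> makes \<open>b powr d * E \<le> C\<close>.\<close>
  define \<delta> where "\<delta> = min \<kappa> (k0 / 2)"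
  define E where "E = 1 / \<delta>\<^sup>2 + A / (\<delta> * k0)"
  define b0 where "b0 = (C / E) powr (1 / d)"
  have C: "C > 0" using kap by (simp add: C_def)
  have A: "A > 0" using C k2 k4 k0 by (simp add: A_def)
  have \<delta>: "\<delta> > 0" "\<delta> \<le> \<kappa>" "\<delta> \<le> k0 / 2" using kap k0 by (auto simp: \<delta>_def)
  have E: "E > 0" using A \<delta> k0 by (simp add: E_def add_pos_pos)
  have b0: "b0 > 0" using C E by (simp add: b0_def)
  have b0d: "\<beta> powr d * E \<le> C" if "0 < \<beta>" "\<beta> \<le> b0" for \<beta>
  proof -
    have "\<beta> powr d \<le> b0 powr d" using that d_gt_1 by (intro powr_mono2) auto
    also have "\<dots> = C / E" using d_gt_1 C E by (simp add: b0_def powr_powr)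
    finally show ?thesis using E by (simp add: field_simps)
  qed
  \<comment> \<open>\<open>b > b0\<close> forces \<open>M \<le> R\<close>. These finitely many cases
    start the induction: the total weight is at least 1, and \<open>c\<close> is small enough for
    that to suffice.\<close>
  define R where "R = nat \<lceil>k4 * b0 powr (-(d + 1))\<rceil>"
  define c where "c = 1 / (1 + (\<Sum>m=1..R. exp (entropy m)))"
  have S: "(\<Sum>m=1..R. exp (entropy m)) \<ge> 0" by (intro sum_nonneg) auto
  have c: "c > 0" using S by (simp add: c_def add_pos_nonneg)
  have mom: "k0 * ?b M powr (-(d + 1)) \<le> real M" "real M \<le> k4 * ?b M powr (-(d + 1))" if "M \<ge> 1" for M
    using low[of 0 "?b M"] k4(2)[of "?b M"] b_sol_pos[OF that] moment_b_sol[OF that] B(2)[OF that] by auto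
  have "c * real M powr (-A) * exp (entropy M) \<le> ?W M" if "M \<ge> 1" for M
    using that
  proof (induction M rule: less_induct)
    case (less M)
    note M = less.prems
    define b where "b = ?b M"
    have b: "b > 0" "b \<le> B" "moment 0 b = real M"
      using b_sol_pos[OF M] B(2)[OF M] moment_b_sol[OF M] by (auto simp: b_def)
    define u where "u = b powr (d + 1)"
    have u: "u > 0" using b by (simp add: u_def)
    have uinv: "b powr (-(d + 1)) = 1 / u" using b by (simp only: u_def powr_minus_divide)
    have Mu: "k0 / u \<le> real M" "real M \<le> k4 / u"
      using mom[OF M] by (simp_all add: b_def[symmetric] uinv del: minus_add_distrib)
    show ?case
    proof (cases "b \<le> b0")
      case False
      have "real M \<le> k4 * b powr (-(d + 1))" using mom[OF M] by (simp add: b_def)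
      also have "\<dots> \<le> k4 * b0 powr (-(d + 1))"
        using False b0 k4 d_gt_1 by (intro mult_left_mono powr_mono2') auto
      finally have "M \<le> R" by (simp add: R_def) linarith
      then have "exp (entropy M) \<le> (\<Sum>m=1..R. exp (entropy m))"
        using M by (intro member_le_sum) auto
      then have "c * exp (entropy M) \<le> 1" using S by (simp add: c_def field_simps)
      moreover have "real M powr (-A) \<le> real M powr 0"
        using M A by (intro powr_mono) auto
      then have "real M powr (-A) * (c * exp (entropy M)) \<le> 1 * (c * exp (entropy M))"
        using M c by (intro mult_right_mono) auto
      ultimately have "c * real M powr (-A) * exp (entropy M) \<le> 1" by (simp add: mult_ac)
      also have "1 \<le> ?W M" by (rule total_weight_Omega_ge_1[of q, OF q_pos])
      finally show ?thesis .
    next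
      case True
      define H where "H = c * real M powr (-A) * exp (entropy M)"
      have H: "H > 0" using c M by (simp add: H_def)
      define v where "v = C * b powr (d + 2)"
      let ?P = "\<lambda>k. 1 + A / real M * real k - v * (real k)\<^sup>2"
      \<comment> \<open>Extended by 0 beyond \<open>M\<close>, so that the full moment series can be
        compared with the finite recurrence term by term.\<close>
      let ?g = "\<lambda>k. if k \<le> M then div_sum q k * ?W (M - k) else 0"
      have W0: "?W m \<ge> 0" for m using total_weight_Omega_ge_1[of q m, OF q_pos] by linarith
      have bd2: "b powr (d + 2) = b * u" using b by (simp add: u_def powr_add power2_eq_square)
      \<comment> \<open>The induction hypothesis gives this for \<open>k \<le> \<delta> / u\<close>. For larger \<open>k\<close> the left side is
        nonpositive, because \<open>v k\<^sup>2\<close> dominates once \<open>b\<close> is small.\<close>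
      have pt: "H * (div_sum q k * exp (-(b * real k)) * ?P k) \<le> ?g k" if k: "k \<ge> 1" for k
      proof (cases "real k \<le> \<delta> / u")
        case good: True
        have "real k \<le> (k0 / u) / 2" using good \<delta> u by (simp add: field_simps)
        also have "\<dots> \<le> real M / 2" using Mu by (intro divide_right_mono) auto
        finally have kM: "real k \<le> real M / 2" .
        then have kM': "k < M" "M - k \<ge> 1" using M k by linarith+
        define b' where "b' = ?b (M - k)"
        have b': "b' > 0" using b_sol_pos[OF kM'(2)] by (simp add: b'_def)
        have "real k \<le> \<kappa> * b powr (-(d + 1))"
          using good \<delta> u unfolding uinv by (simp add: field_simps)
        from kap(2)[OF b(1,2) b' _ this]
        have ent: "entropy M - b * real k - v * (real k)\<^sup>2 \<le> entropy (M - k)"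
          using kM' by (simp add: entropy_def b_def[symmetric] b'_def[symmetric] b v_def C_def
              of_nat_diff algebra_simps)
        \<comment> \<open>The gain from the decreasing factor \<open>M powr (-A)\<close>, by
          \<open>ln (1 - z) \<le> -z\<close>.\<close>
        have "A * ln (real M - real k) \<le> A * (ln (real M) - real k / real M)"
        proof (rule mult_left_mono)
          have "ln (1 - real k / real M) \<le> - (real k / real M)"
            using ln_le_minus_one[of "1 - real k / real M"] kM' by simp
          moreover have "ln (real M - real k) = ln (real M) + ln (1 - real k / real M)"
          proof -
            have "real M * (1 - real k / real M) = real M - real k" using M by (simp add: field_simps)
            moreover have "1 - real k / real M > 0" using kM' by simp
            ultimately show ?thesis using M ln_mult_pos[of "real M" "1 - real k / real M"] by simp
          qed
          ultimately show "ln (real M - real k) \<le> ln (real M) - real k / real M" by simp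
        qed (use A in simp)
        then have pw: "real M powr (-A) * exp (A / real M * real k) \<le> real (M - k) powr (-A)"
          using kM' by (simp add: powr_def of_nat_diff exp_add[symmetric] algebra_simps)
        \<comment> \<open>Linearising by \<open>1 + z \<le> exp z\<close> is what reduces the mean
          over \<open>k\<close> to the moments of order 0, 1 and 2.\<close>
        have "H * (exp (-(b * real k)) * ?P k) \<le> H * (exp (-(b * real k)) * exp (A / real M * real k - v * (real k)\<^sup>2))"
          using H exp_ge_add_one_self[of "A / real M * real k - v * (real k)\<^sup>2"]
          by (intro mult_left_mono) (auto simp: algebra_simps)
        also have "\<dots> = c * (real M powr (-A) * exp (A / real M * real k)) * exp (entropy M - b * real k - v * (real k)\<^sup>2)"
          by (simp add: H_def exp_add[symmetric] exp_diff exp_minus field_simps)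
        also have "\<dots> \<le> c * real (M - k) powr (-A) * exp (entropy (M - k))"
          using c ent pw by (intro mult_mono) auto
        also have "\<dots> \<le> ?W (M - k)" using less.IH[OF _ kM'(2)] kM' k by simp
        finally have "div_sum q k * (H * (exp (-(b * real k)) * ?P k)) \<le> div_sum q k * ?W (M - k)"
          by (intro mult_left_mono) auto
        then show ?thesis using kM' by (simp add: mult_ac)
      next
        case False
        then have ku: "\<delta> < real k * u" using u by (simp add: field_simps)
        define y where "y = real k * u"
        have y: "\<delta> < y" using ku by (simp add: y_def)
        have "1 \<le> y\<^sup>2 / \<delta>\<^sup>2" using y \<delta> by (simp add: power_mono)
        moreover have "A / real M * real k \<le> y\<^sup>2 * (A / (\<delta> * k0))"
        proof -
          have "1 / real M \<le> u / k0" using Mu k0 u M by (simp add: field_simps)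
          then have "A * real k * (1 / real M) \<le> A * real k * (u / k0)" using A by (intro mult_left_mono) auto
          also have "\<dots> = A / k0 * y" by (simp add: y_def)
          also have "\<dots> \<le> A / k0 * (y * (y / \<delta>))"
            using A k0 y \<delta> by (intro mult_left_mono) (auto simp: field_simps)
          finally show ?thesis by (simp add: power2_eq_square mult_ac)
        qed
        ultimately have "1 + A / real M * real k \<le> y\<^sup>2 * E" by (simp add: E_def algebra_simps)
        also have "y\<^sup>2 * E = (real k)\<^sup>2 * (b powr (d + 2)) * (b powr d * E)"
          using b unfolding bd2 by (simp add: y_def u_def powr_add power2_eq_square)
        also have "\<dots> \<le> (real k)\<^sup>2 * (b powr (d + 2)) * C"
          using b0d[OF b(1) True] by (intro mult_left_mono) auto
        also have "\<dots> = v * (real k)\<^sup>2" by (simp add: v_def)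
        finally have "?P k \<le> 0" by simp
        then have "H * (div_sum q k * exp (-(b * real k)) * ?P k) \<le> 0"
          using H by (intro mult_nonneg_nonpos) auto
        also have "0 \<le> ?g k" using W0 by simp
        finally show ?thesis .
      qed
      have hs: "(?g has_sum (\<Sum>k=1..M. div_sum q k * ?W (M - k))) {1..}"
        by (rule has_sum_finite_neutralI[of "{1..M}"]) auto
      have "H * (moment 0 b + A / real M * moment 1 b - v * moment 2 b) \<le> (\<Sum>k=1..M. div_sum q k * ?W (M - k))"
        by (rule has_sum_mono[OF moment_combination_has_sum[OF b(1)] hs]) (use pt in auto)
      also have "\<dots> \<le> real M * ?W M" by (rule total_weight_recurrence[of q, OF q_pos])
      finally have main: "H * (moment 0 b + A / real M * moment 1 b - v * moment 2 b) \<le> real M * ?W M" .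
      \<comment> \<open>Both sides are of order \<open>1 / b\<close>; the exponent \<open>A\<close> is chosen so that this holds.\<close>
      have "v * moment 2 b \<le> A / real M * moment 1 b"
      proof -
        have e1: "b powr (-(d + 2 + 1)) = 1 / (b\<^sup>2 * u)"
          using b by (simp only: powr_minus_divide) (simp add: u_def powr_add power2_eq_square power3_eq_cube)
        have e2: "b powr (-(d + 1 + 1)) = 1 / (b * u)"
          using b by (simp only: powr_minus_divide) (simp add: u_def powr_add power2_eq_square)
        have "v * moment 2 b \<le> v * (k2 * (1 / (b\<^sup>2 * u)))"
          unfolding e1[symmetric] using C b by (intro mult_left_mono k2) (auto simp: v_def)
        also have "\<dots> = C * k2 / b" using b u by (simp add: v_def bd2 power2_eq_square)
        also have "\<dots> = A * (u / k4) * (k0 * (1 / (b * u)))"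
          using b u k0 k4 by (simp add: A_def)
        also have "\<dots> \<le> A * (1 / real M) * moment 1 b"
        proof (intro mult_mono)
          show "u / k4 \<le> 1 / real M" using Mu u k4 M by (simp add: field_simps)
          show "k0 * (1 / (b * u)) \<le> moment 1 b" using low[of 1 b] b unfolding e2 by simp
        qed (use A k0 k4 b u in auto)
        finally show ?thesis by simp
      qed
      then have "H * real M \<le> H * (moment 0 b + A / real M * moment 1 b - v * moment 2 b)"
        using H b by (intro mult_left_mono) auto
      with main have "H * real M \<le> ?W M * real M" by (simp add: mult.commute)
      then show ?thesis using M by (simp add: H_def)
    qed
  qed
  then show ?thesis by (intro that[of A c]) (use A c in auto)
qed

end

section \<open>Chernoff bound\<close>

text \<open>Second-order Taylor expansion of the cumulant generating function of one level. The
  range of \<theta> keeps \<open>y - \<theta>\<close> at least \<open>y / 2\<close>, away from the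
  singularity at 0.\<close>

lemma log_mgf_le:
  fixes y \<theta> :: real
  assumes y: "y > 0" and \<theta>: "\<bar>\<theta>\<bar> \<le> y / 2"
  shows "- ln (1 - exp (-(y - \<theta>)))
    \<le> - ln (1 - exp (-y)) + \<theta> / (exp y - 1) + 32 * \<theta>\<^sup>2 * (exp (-(y / 4)) / y\<^sup>2)"
proof (cases "\<theta> = 0")
  case False
  define h where "h = (\<lambda>(m::nat) (t::real). if m = 0 then - ln (1 - exp (t - y))
    else if m = 1 then exp (t - y) / (1 - exp (t - y)) else exp (t - y) / (1 - exp (t - y))\<^sup>2)"
  have "\<exists>t. (if \<theta> < 0 then \<theta> < t \<and> t < 0 else 0 < t \<and> t < \<theta>) \<and>
    h 0 \<theta> = (\<Sum>m<2. h m 0 / fact m * (\<theta> - 0) ^ m) + h 2 t / fact 2 * (\<theta> - 0) ^ 2"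
  proof (rule Taylor[where a = "-(y / 2)" and b = "y / 2"])
    show "\<forall>m t. m < 2 \<and> - (y / 2) \<le> t \<and> t \<le> y / 2 \<longrightarrow> (h m has_real_derivative h (Suc m) t) (at t)"
    proof (intro allI impI)
      fix m :: nat and t assume a: "m < 2 \<and> - (y / 2) \<le> t \<and> t \<le> y / 2"
      then have "exp (t - y) < 1" using y by simp
      moreover from a have "m = 0 \<or> m = 1" by auto
      ultimately show "(h m has_real_derivative h (Suc m) t) (at t)"
        by (auto simp: h_def fun_eq_iff power2_eq_square field_simps intro!: derivative_eq_intros)
    qed
  qed (use y \<theta> False in auto)
  then obtain t where t0: "if \<theta> < 0 then \<theta> < t \<and> t < 0 else 0 < t \<and> t < \<theta>"
    and eq: "h 0 \<theta> = (\<Sum>m<2. h m 0 / fact m * (\<theta> - 0) ^ m) + h 2 t / fact 2 * (\<theta> - 0) ^ 2" by blast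
  have t: "\<bar>t\<bar> \<le> y / 2" "h 0 \<theta> = h 0 0 + h 1 0 * \<theta> + h 2 t / 2 * \<theta>\<^sup>2"
    using t0 \<theta> eq by (auto simp: numeral_2_eq_2 split: if_splits)
  define u where "u = y / 2"
  have u: "u > 0" using y by (simp add: u_def)
  \<comment> \<open>Adequate for small and large \<open>u\<close> alike; squared in the denominator,
    it costs only half of the decay of \<open>exp (-u)\<close>.\<close>
  have "u / 4 * exp (-(u / 4)) \<le> 1 - exp (-u)"
  proof -
    have "u / 4 * exp (u / 4) * exp (u / 2) \<le> (exp (u / 2) - 1) * (exp (u / 2) + 1)"
      using exp_minus_one_ge[of "u / 2"] u by (intro mult_mono) auto
    also have "\<dots> = exp u - 1" by (simp add: algebra_simps exp_add[symmetric])
    finally have "exp (-u) * (u / 4 * exp (u / 4) * exp (u / 2)) \<le> exp (-u) * (exp u - 1)"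
      by (intro mult_left_mono) auto
    moreover have "exp (-u) * (u / 4 * exp (u / 4) * exp (u / 2)) = u / 4 * exp (-u + u / 4 + u / 2)"
      unfolding exp_add by simp
    moreover have "-u + u / 4 + u / 2 = -(u / 4)" by simp
    moreover have "exp (-u) * (exp u - 1) = 1 - exp (-u)"
      by (simp add: right_diff_distrib exp_add[symmetric])
    ultimately show ?thesis by metis
  qed
  also have "\<dots> \<le> 1 - exp (t - y)" using t u by (simp add: u_def)
  finally have den: "u / 4 * exp (-(u / 4)) \<le> 1 - exp (t - y)" .
  have "h 2 t = exp (t - y) / (1 - exp (t - y))\<^sup>2" by (simp add: h_def)
  also have "\<dots> \<le> exp (-u) / (u / 4 * exp (-(u / 4)))\<^sup>2"
    using den t u by (intro frac_le power_mono) (auto simp: u_def)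
  also have "\<dots> = 16 * exp (-(u / 2)) / u\<^sup>2"
  proof -
    have "(exp (-(u / 4)))\<^sup>2 = exp (-(u / 2))" by (simp add: power2_eq_square exp_add[symmetric])
    moreover have "exp (-u) = exp (-(u / 2)) * exp (-(u / 2))" by (simp add: exp_add[symmetric])
    ultimately show ?thesis using u by (simp add: power_mult_distrib power_divide)
  qed
  also have "\<dots> = 64 * (exp (-(y / 4)) / y\<^sup>2)" by (simp add: u_def power_divide)
  finally have "h 2 t / 2 * \<theta>\<^sup>2 \<le> (64 * (exp (-(y / 4)) / y\<^sup>2)) / 2 * \<theta>\<^sup>2"
    by (intro mult_right_mono divide_right_mono) auto
  moreover have "h 1 0 = 1 / (exp y - 1)" using y by (simp add: h_def exp_minus field_simps)
  ultimately show ?thesis using t(2) by (simp add: h_def mult_ac)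
qed simp

context boson_gas
begin

text \<open>Up to the factor 64 this dominates the grand canonical variance, the sum of
  \<open>q j * exp y / (exp y - 1)\<^sup>2\<close> at \<open>y = b * j\<close>, in a form stable
  under tilts up to \<open>b / 2\<close>.\<close>

definition variance_bound :: "real \<Rightarrow> real" where
  "variance_bound b = (\<Sum>\<^sub>\<infinity>j\<in>{1..}. q j * (exp (-(b * real j / 4)) / (b * real j)\<^sup>2))"

lemma variance_term_le:
  assumes "j \<ge> 1" "b > 0"
  shows "q j * (exp (-(b * real j / 4)) / (b * real j)\<^sup>2)
    \<le> c2 / b\<^sup>2 * (real j powr (d - 3) * exp (-(b / 4 * real j)))"
proof -
  have e: "real j powr (d - 1) = real j powr (d - 3) * (real j)\<^sup>2"
    using assms powr_add[of "real j" "d - 3" 2] by (simp add: add.commute)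
  have "q j * (exp (-(b * real j / 4)) / (b * real j)\<^sup>2)
      \<le> c2 * real j powr (d - 1) * (exp (-(b * real j / 4)) / (b * real j)\<^sup>2)"
    using assms by (intro mult_right_mono q_upper) auto
  also have "\<dots> = c2 / b\<^sup>2 * (real j powr (d - 3) * exp (-(b / 4 * real j)))"
    unfolding e using assms by (simp add: power_mult_distrib)
  finally show ?thesis .
qed

lemma variance_has_sum:
  assumes "b > 0"
  shows "((\<lambda>j. q j * (exp (-(b * real j / 4)) / (b * real j)\<^sup>2)) has_sum variance_bound b) {1..}"
proof -
  obtain K where K: "\<And>b. b > 0 \<Longrightarrow> (\<lambda>k. real k powr (d - 2) * exp (-(b * real k))) summable_on {1..}"
    using sum_powr_exp_upper[of "d - 2"] d_gt_1 by auto
  have "(\<lambda>j. q j * (exp (-(b * real j / 4)) / (b * real j)\<^sup>2)) summable_on {1..}"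
  proof (rule summable_on_comparison_test)
    \<comment> \<open>The exponent \<open>d - 3\<close> may be at most \<open>-1\<close>, outside
      the range of \<open>sum_powr_exp_upper\<close>; for \<open>j \<ge> 1\<close> it may be raised
      to \<open>d - 2\<close>.\<close>
    show "(\<lambda>j. c2 / b\<^sup>2 * (real j powr (d - 2) * exp (-(b / 4 * real j)))) summable_on {1..}"
      using assms by (intro summable_on_cmult_right K) auto
    fix j :: nat assume j: "j \<in> {1..}"
    have "q j * (exp (-(b * real j / 4)) / (b * real j)\<^sup>2)
        \<le> c2 / b\<^sup>2 * (real j powr (d - 3) * exp (-(b / 4 * real j)))"
      using j assms by (intro variance_term_le) auto
    also have "\<dots> \<le> c2 / b\<^sup>2 * (real j powr (d - 2) * exp (-(b / 4 * real j)))"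
      using j c2_pos by (intro mult_left_mono mult_right_mono powr_mono) auto
    finally show "q j * (exp (-(b * real j / 4)) / (b * real j)\<^sup>2)
        \<le> c2 / b\<^sup>2 * (real j powr (d - 2) * exp (-(b / 4 * real j)))" .
    show "0 \<le> q j * (exp (-(b * real j / 4)) / (b * real j)\<^sup>2)" using q_pos[of j] j by simp
  qed
  then show ?thesis by (simp add: variance_bound_def)
qed

lemma variance_bound_gt_2:
  assumes "d > 2"
  obtains K where "K > 0" "\<And>b. b > 0 \<Longrightarrow> variance_bound b \<le> K * b powr (-d)"
proof -
  obtain K where K: "K > 0"
    "\<And>b. b > 0 \<Longrightarrow> (\<lambda>k. real k powr (d - 3) * exp (-(b * real k))) summable_on {1..}"
    "\<And>b. b > 0 \<Longrightarrow> (\<Sum>\<^sub>\<infinity>k\<in>{1..}. real k powr (d - 3) * exp (-(b * real k))) \<le> K * b powr (-(d - 3 + 1))"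
    using sum_powr_exp_upper[of "d - 3"] assms by auto
  show ?thesis
  proof (rule that)
    fix b :: real assume b: "b > 0"
    then have b4: "b / 4 > 0" by simp
    have "variance_bound b \<le> c2 / b\<^sup>2 * (\<Sum>\<^sub>\<infinity>k\<in>{1..}. real k powr (d - 3) * exp (-(b / 4 * real k)))"
      by (rule has_sum_mono[OF variance_has_sum[OF b] has_sum_cmult_right[OF has_sum_infsum[OF K(2)[OF b4]]]])
         (use variance_term_le b in auto)
    also have "\<dots> \<le> c2 / b\<^sup>2 * (K * (b / 4) powr (-(d - 3 + 1)))"
      using c2_pos b4 by (intro mult_left_mono K(3)) auto
    also have "\<dots> = c2 * K * 4 powr (d - 2) * (b powr (-(d - 2)) / b powr 2)"
    proof -
      have "(b / 4) powr (-(d - 2)) = b powr (-(d - 2)) / 4 powr (-(d - 2))"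
        by (rule powr_divide)
      also have "\<dots> = 4 powr (d - 2) * b powr (-(d - 2))"
        unfolding powr_minus_divide[of 4 "d - 2"] by simp
      finally have e: "(b / 4) powr (-(d - 3 + 1)) = 4 powr (d - 2) * b powr (-(d - 2))"
        by (simp add: algebra_simps)
      show ?thesis unfolding e using b by simp
    qed
    also have "b powr (-(d - 2)) / b powr 2 = b powr (-d)"
      by (simp add: powr_diff[symmetric])
    finally show "variance_bound b \<le> c2 * K * 4 powr (d - 2) * b powr (-d)" .
  qed (use c2_pos K in simp)
qed

text \<open>Raising the exponent \<open>d - 3\<close> to \<open>-1\<close> gives a logarithmic
  series, exact in order at \<open>d = 2\<close>. The logarithm is affordable since the Chernoff
  exponent also contains \<open>ln Nbar\<close>.\<close>

lemma variance_bound_le_2: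
  assumes "d \<le> 2" "b > 0"
  shows "b\<^sup>2 * variance_bound b \<le> c2 * (ln (4 / b) + b / 4)"
proof -
  have b4: "b / 4 > 0" using assms by simp
  have "variance_bound b \<le> c2 / b\<^sup>2 * (- ln (1 - exp (-(b / 4))))"
  proof (rule has_sum_mono[OF variance_has_sum[OF assms(2)] has_sum_cmult_right[OF has_sum_ln_one_minus[OF b4]]])
    fix j :: nat assume j: "j \<in> {1..}"
    have "q j * (exp (-(b * real j / 4)) / (b * real j)\<^sup>2)
        \<le> c2 / b\<^sup>2 * (real j powr (d - 3) * exp (-(b / 4 * real j)))"
      using j assms by (intro variance_term_le) auto
    also have "\<dots> \<le> c2 / b\<^sup>2 * (real j powr (-1) * exp (-(b / 4 * real j)))"
      using j c2_pos assms by (intro mult_left_mono mult_right_mono powr_mono) auto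
    finally show "q j * (exp (-(b * real j / 4)) / (b * real j)\<^sup>2)
        \<le> c2 / b\<^sup>2 * (exp (-(b / 4 * real j)) / real j)"
      using j by (simp add: powr_minus_divide)
  qed
  also have "- ln (1 - exp (-(b / 4))) \<le> ln (4 / b) + b / 4"
  proof -
    have "b / 4 * exp (-(b / 4)) \<le> (exp (b / 4) - 1) * exp (-(b / 4))"
    proof (rule mult_right_mono)
      show "b / 4 \<le> exp (b / 4) - 1" using exp_ge_add_one_self[of "b / 4"] by linarith
    qed simp
    also have "\<dots> = 1 - exp (-(b / 4))" by (simp add: left_diff_distrib exp_add[symmetric])
    finally have "ln (b / 4 * exp (-(b / 4))) \<le> ln (1 - exp (-(b / 4)))"
      using assms by (intro ln_mono) auto
    also have "ln (b / 4 * exp (-(b / 4))) = ln (b / 4) - b / 4"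
      using assms by (subst ln_mult_pos) auto
    finally show ?thesis using assms by (simp add: ln_div)
  qed
  finally have "variance_bound b \<le> c2 / b\<^sup>2 * (ln (4 / b) + b / 4)"
    using c2_pos by (simp add: mult_left_mono divide_right_mono)
  then show ?thesis using assms by (simp add: field_simps)
qed

lemma Nbar_at_has_sum:
  assumes "M \<ge> 1"
  shows "(Nbar_at q M has_sum Nbar q M) {1..}" "\<And>j. j \<ge> 1 \<Longrightarrow> Nbar_at q M j \<ge> 0"
proof -
  have "Nbar_at q M summable_on {1..}" 
    using occupation_summable[OF b_sol_pos[OF assms]] by (simp add: Nbar_at_def[abs_def])
  then show "(Nbar_at q M has_sum Nbar q M) {1..}" by (simp add: Nbar_def)
  show "\<And>j. j \<ge> 1 \<Longrightarrow> Nbar_at q M j \<ge> 0"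
    using occupation_nonneg b_sol_pos[OF assms] by (simp add: Nbar_at_def)
qed

text \<open>On the event, \<open>exp (b * (M - energy) + t * (deviation - T))\<close> is at least 1.
  Inserting it and then dropping the event leaves the generating function at \<open>x j\<close>,
  whose first-order terms cancel the centring. \<open>t \<le> b / 2\<close> puts
  \<open>t * g j\<close> within the range of \<open>log_mgf_le\<close> at every level.\<close>

lemma chernoff:
  assumes M: "M \<ge> 1" and g: "\<And>j. j \<ge> 1 \<Longrightarrow> \<bar>g j\<bar> \<le> (1::real)"
    and t: "0 \<le> t" "t \<le> b_sol q M / 2"
  shows "total_weight q {N \<in> Omega M. T < (\<Sum>j=1..M. g j * real (N j)) - (\<Sum>\<^sub>\<infinity>j\<in>{1..}. g j * Nbar_at q M j)}
    \<le> exp (entropy M + 32 * t\<^sup>2 * variance_bound (b_sol q M) - t * T)"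
proof -
  define b where "b = b_sol q M"
  have b: "b > 0" using b_sol_pos[OF M] by (simp add: b_def)
  define S where "S = (\<Sum>\<^sub>\<infinity>j\<in>{1..}. g j * Nbar_at q M j)"
  have "(\<lambda>j. g j * Nbar_at q M j) summable_on {1..}"
  proof (rule abs_summable_summable, rule summable_on_comparison_test)
    show "Nbar_at q M summable_on {1..}" using Nbar_at_has_sum(1)[OF M] by (rule has_sum_imp_summable)
    fix j :: nat assume "j \<in> {1..}"
    then show "norm (g j * Nbar_at q M j) \<le> Nbar_at q M j"
      using g[of j] Nbar_at_has_sum(2)[OF M, of j] by (simp add: abs_mult mult_left_le_one_le)
  qed simp
  then have S: "((\<lambda>j. g j * Nbar_at q M j) has_sum S) {1..}" by (simp add: S_def)
  let ?E = "{N \<in> Omega M. T < (\<Sum>j=1..M. g j * real (N j)) - S}"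
  define x where "x = (\<lambda>j. exp (-(b * real j - t * g j)))"
  have tg: "\<bar>t * g j\<bar> \<le> b * real j / 2" if "j \<ge> 1" for j
  proof -
    have "\<bar>t * g j\<bar> \<le> t * 1" using t g[OF that] unfolding abs_mult by (intro mult_mono) auto
    also have "\<dots> \<le> b / 2" using t by (simp add: b_def)
    also have "\<dots> \<le> b * real j / 2" using b that by simp
    finally show ?thesis .
  qed
  have x01: "0 \<le> x j \<and> x j < 1" if "j \<ge> 1" for j
  proof -
    have "b * real j / 2 < b * real j" using b that by simp
    then have "t * g j < b * real j" using tg[OF that] by linarith
    then show ?thesis by (simp add: x_def)
  qed
  let ?R = "\<lambda>j. - q j * ln (1 - exp (-(b * real j))) + t * (g j * Nbar_at q M j)
      + 32 * t\<^sup>2 * (q j * (exp (-(b * real j / 4)) / (b * real j)\<^sup>2))"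
  have LR: "- q j * ln (1 - x j) \<le> ?R j" if j: "j \<ge> 1" for j
  proof -
    have y: "b * real j > 0" using b j by simp
    have "q j * (- ln (1 - x j)) \<le> q j * (- ln (1 - exp (-(b * real j))) + t * g j / (exp (b * real j) - 1)
        + 32 * (t * g j)\<^sup>2 * (exp (-(b * real j / 4)) / (b * real j)\<^sup>2))"
      unfolding x_def using q_pos[OF j] by (intro mult_left_mono log_mgf_le[OF y tg[OF j]]) auto
    also have "\<dots> \<le> q j * (- ln (1 - exp (-(b * real j))) + t * g j / (exp (b * real j) - 1)
        + 32 * t\<^sup>2 * (exp (-(b * real j / 4)) / (b * real j)\<^sup>2))"
    proof -
      have "(g j)\<^sup>2 \<le> 1" using g[OF j] by (simp add: abs_square_le_1)
      then have "(t * g j)\<^sup>2 \<le> t\<^sup>2" by (simp add: power_mult_distrib mult_left_le)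
      then show ?thesis
        using q_pos[OF j] by (intro mult_left_mono add_left_mono mult_right_mono) auto
    qed
    also have "\<dots> = ?R j" by (simp add: Nbar_at_def b_def algebra_simps)
    finally show ?thesis by simp
  qed
  have L0: "0 \<le> - q j * ln (1 - x j)" if j: "j \<ge> 1" for j
  proof -
    have "ln (1 - x j) \<le> 0" using x01[OF j] by simp
    then show ?thesis using q_pos[OF j] by (simp add: mult_nonneg_nonpos)
  qed
  have R: "(?R has_sum (moment (-1) b + t * S + 32 * t\<^sup>2 * variance_bound b)) {1..}"
    using b by (intro has_sum_add has_sum_cmult_right log_partition_has_sum S variance_has_sum)
  have "(\<Sum>j=1..M. - q j * ln (1 - x j)) \<le> (\<Sum>j=1..M. ?R j)"
    by (intro sum_mono LR) auto
  \<comment> \<open>\<open>?R j\<close> dominates the nonnegative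
    \<open>- q j * ln (1 - x j)\<close>, so the terms beyond \<open>M\<close> may be added.\<close>
  also have "\<dots> \<le> moment (-1) b + t * S + 32 * t\<^sup>2 * variance_bound b"
    by (rule finite_sum_le_has_sum[OF R]) (use order_trans[OF L0 LR] in auto)
  finally have sumL: "(\<Sum>j=1..M. - q j * ln (1 - x j)) \<le> moment (-1) b + t * S + 32 * t\<^sup>2 * variance_bound b" .
  have "total_weight q ?E \<le> (\<Sum>N\<in>?E. exp (b * real M - t * S - t * T) * (weight q N * (\<Prod>j=1..M. x j ^ N j)))"
    unfolding total_weight_def
  proof (rule sum_mono)
    fix N assume N: "N \<in> ?E"
    then have w: "weight q N \<ge> 0" using weight_nonneg[of q N M, OF q_pos] by simp
    have en: "(\<Sum>j=1..M. real j * real (N j)) \<le> real M"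
      using N Omega_iff[of M M N] by (simp flip: of_nat_mult of_nat_sum)
    have "(\<Prod>j=1..M. x j ^ N j) = exp (\<Sum>j=1..M. real (N j) * (-(b * real j - t * g j)))"
      by (simp add: x_def exp_sum exp_of_nat_mult)
    also have "(\<Sum>j=1..M. real (N j) * (-(b * real j - t * g j)))
        = t * (\<Sum>j=1..M. g j * real (N j)) - b * (\<Sum>j=1..M. real j * real (N j))"
      by (simp add: sum_distrib_left sum_subtractf[symmetric] algebra_simps)
    finally have "exp (b * real M - t * S - t * T) * (\<Prod>j=1..M. x j ^ N j)
        = exp (b * (real M - (\<Sum>j=1..M. real j * real (N j))) + t * ((\<Sum>j=1..M. g j * real (N j)) - S - T))"
      by (simp add: exp_add[symmetric] algebra_simps)
    moreover have "b * (real M - (\<Sum>j=1..M. real j * real (N j))) \<ge> 0"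
      using b en by (intro mult_nonneg_nonneg) auto
    moreover have "t * ((\<Sum>j=1..M. g j * real (N j)) - S - T) \<ge> 0"
      using t N by (intro mult_nonneg_nonneg) auto
    ultimately have "1 \<le> exp (b * real M - t * S - t * T) * (\<Prod>j=1..M. x j ^ N j)" by simp
    then have "weight q N * 1 \<le> weight q N * (exp (b * real M - t * S - t * T) * (\<Prod>j=1..M. x j ^ N j))"
      using w by (intro mult_left_mono) auto
    then show "weight q N \<le> exp (b * real M - t * S - t * T) * (weight q N * (\<Prod>j=1..M. x j ^ N j))"
      by (simp add: mult_ac)
  qed
  also have "\<dots> = exp (b * real M - t * S - t * T) * (\<Sum>N\<in>?E. weight q N * (\<Prod>j=1..M. x j ^ N j))"
    by (simp add: sum_distrib_left)
  also have "\<dots> \<le> exp (b * real M - t * S - t * T) * (\<Sum>N\<in>Omega M. weight q N * (\<Prod>j=1..M. x j ^ N j))"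
    using x01 weight_nonneg[of q _ M, OF q_pos]
    by (intro mult_left_mono sum_mono2) (auto intro!: mult_nonneg_nonneg prod_nonneg finite_Omega)
  also have "\<dots> \<le> exp (b * real M - t * S - t * T) * (\<Prod>j=1..M. (1 - x j) powr (- q j))"
    using x01 by (intro mult_left_mono weighted_generating_bound q_pos) auto
  also have "(\<Prod>j=1..M. (1 - x j) powr (- q j)) = exp (\<Sum>j=1..M. - q j * ln (1 - x j))"
    unfolding exp_sum[OF finite_atLeastAtMost]
  proof (rule prod.cong[OF refl])
    fix j assume "j \<in> {1..M}"
    then have "x j < 1" using x01[of j] by simp
    then show "(1 - x j) powr (- q j) = exp (- q j * ln (1 - x j))" by (simp add: powr_def)
  qed
  also have "exp (b * real M - t * S - t * T) * exp (\<Sum>j=1..M. - q j * ln (1 - x j))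
      \<le> exp (b * real M - t * S - t * T) * exp (moment (-1) b + t * S + 32 * t\<^sup>2 * variance_bound b)"
    using sumL by (intro mult_left_mono) auto
  also have "\<dots> = exp (entropy M + 32 * t\<^sup>2 * variance_bound b - t * T)"
    by (simp add: exp_add[symmetric] entropy_def b_def)
  finally show ?thesis by (simp add: S_def b_def)
qed

section \<open>Concentration\<close>

text \<open>The dictionary between \<open>b\<close> and \<open>Nbar\<close>: it bounds negative
  powers of \<open>b\<close> by powers of \<open>Nbar\<close>.\<close>

lemma Nbar_lower:
  obtains n where "n > 0" "\<And>M. M \<ge> 1 \<Longrightarrow> n * b_sol q M powr (-d) \<le> Nbar q M"
proof -
  obtain B where B: "B > 0" "\<And>M. M \<ge> 1 \<Longrightarrow> b_sol q M \<le> B" by (rule b_sol_bounded) blast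
  show ?thesis
  proof (rule that)
    fix M :: nat assume M: "M \<ge> 1"
    show "c1 * exp (-2 * (1 + B)) * b_sol q M powr (-d) \<le> Nbar q M"
      using occupation_sum_lower[OF b_sol_pos[OF M] B(2)[OF M]] by (simp add: Nbar_def Nbar_at_def)
  qed (use c1_pos in simp)
qed

text \<open>The modulus is at most the sum of the absolute real and imaginary parts, so one of four
  signed real sums exceeds half the threshold.\<close>

lemma chernoff_complex:
  assumes M: "M \<ge> 1" and f: "\<And>j. j \<ge> 1 \<Longrightarrow> cmod (f j) \<le> 1"
    and t: "0 \<le> t" "t \<le> b_sol q M / 2"
  shows "total_weight q {N \<in> Omega M.
      D < cmod (\<Sum>\<^sub>\<infinity>j\<in>{1..}. f j * complex_of_real (real (N j) - Nbar_at q M j))}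
    \<le> 4 * exp (entropy M + 32 * t\<^sup>2 * variance_bound (b_sol q M) - t * (D / 2))"
proof -
  let ?n = "Nbar_at q M"
  define Ev where "Ev g = {N \<in> Omega M. D / 2 < (\<Sum>j=1..M. g j * real (N j)) - (\<Sum>\<^sub>\<infinity>j\<in>{1..}. g j * ?n j)}"
    for g :: "nat \<Rightarrow> real"
  have fs: "(\<lambda>j. f j * complex_of_real (?n j)) summable_on {1..}"
  proof (rule abs_summable_summable, rule summable_on_comparison_test)
    show "?n summable_on {1..}" using Nbar_at_has_sum(1)[OF M] by (rule has_sum_imp_summable)
    fix j :: nat assume "j \<in> {1..}"
    then show "norm (f j * complex_of_real (?n j)) \<le> ?n j"
      using f[of j] Nbar_at_has_sum(2)[OF M, of j] by (simp add: norm_mult mult_left_le_one_le)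
  qed simp
  define S where "S = (\<Sum>\<^sub>\<infinity>j\<in>{1..}. f j * complex_of_real (?n j))"
  have ReS: "(\<Sum>\<^sub>\<infinity>j\<in>{1..}. Re (f j) * ?n j) = Re S" "(\<Sum>\<^sub>\<infinity>j\<in>{1..}. Im (f j) * ?n j) = Im S"
    using infsum_Re[OF fs] infsum_Im[OF fs] by (simp_all add: S_def)
  have sub: "{N \<in> Omega M. D < cmod (\<Sum>\<^sub>\<infinity>j\<in>{1..}. f j * complex_of_real (real (N j) - ?n j))}
    \<subseteq> (Ev (\<lambda>j. Re (f j)) \<union> Ev (\<lambda>j. - Re (f j))) \<union> (Ev (\<lambda>j. Im (f j)) \<union> Ev (\<lambda>j. - Im (f j)))"
  proof
    fix N assume "N \<in> {N \<in> Omega M. D < cmod (\<Sum>\<^sub>\<infinity>j\<in>{1..}. f j * complex_of_real (real (N j) - ?n j))}"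
    then have N: "N \<in> Omega M" "D < cmod (\<Sum>\<^sub>\<infinity>j\<in>{1..}. f j * complex_of_real (real (N j) - ?n j))" by auto
    define X where "X = (\<Sum>j=1..M. f j * complex_of_real (real (N j))) - S"
    have "((\<lambda>j. f j * complex_of_real (real (N j))) has_sum (\<Sum>j=1..M. f j * complex_of_real (real (N j)))) {1..}"
      by (rule has_sum_finite_neutralI[of "{1..M}"]) (use Omega_support[OF N(1)] in auto)
    from has_sum_add[OF this has_sum_uminusI[OF has_sum_infsum[OF fs]]]
    have "((\<lambda>j. f j * complex_of_real (real (N j) - ?n j)) has_sum X) {1..}"
      by (simp add: X_def S_def algebra_simps)
    then have "D < cmod X" using N(2) by (simp add: infsumI)
    also have "\<dots> \<le> \<bar>Re X\<bar> + \<bar>Im X\<bar>" by (rule cmod_le)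
    finally have "D / 2 < \<bar>Re X\<bar> \<or> D / 2 < \<bar>Im X\<bar>" by linarith
    then show "N \<in> (Ev (\<lambda>j. Re (f j)) \<union> Ev (\<lambda>j. - Re (f j))) \<union> (Ev (\<lambda>j. Im (f j)) \<union> Ev (\<lambda>j. - Im (f j)))"
    proof -
      have "N \<in> Ev (\<lambda>j. Re (f j)) \<longleftrightarrow> D / 2 < Re X" "N \<in> Ev (\<lambda>j. - Re (f j)) \<longleftrightarrow> D / 2 < - Re X"
        "N \<in> Ev (\<lambda>j. Im (f j)) \<longleftrightarrow> D / 2 < Im X" "N \<in> Ev (\<lambda>j. - Im (f j)) \<longleftrightarrow> D / 2 < - Im X"
        using N(1) unfolding Ev_def mult_minus_left infsum_uminus sum_negf ReS by (simp_all add: X_def)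
      moreover have "D / 2 < Re X \<or> D / 2 < - Re X \<or> D / 2 < Im X \<or> D / 2 < - Im X"
        using \<open>D / 2 < \<bar>Re X\<bar> \<or> D / 2 < \<bar>Im X\<bar>\<close> by linarith
      ultimately show ?thesis by blast
    qed
  qed
  have "total_weight q {N \<in> Omega M.
      D < cmod (\<Sum>\<^sub>\<infinity>j\<in>{1..}. f j * complex_of_real (real (N j) - ?n j))}
    \<le> total_weight q ((Ev (\<lambda>j. Re (f j)) \<union> Ev (\<lambda>j. - Re (f j))) \<union> (Ev (\<lambda>j. Im (f j)) \<union> Ev (\<lambda>j. - Im (f j))))"
    by (rule total_weight_mono[OF q_pos sub]) (auto simp: Ev_def)
  also have "\<dots> \<le> (total_weight q (Ev (\<lambda>j. Re (f j))) + total_weight q (Ev (\<lambda>j. - Re (f j))))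
      + (total_weight q (Ev (\<lambda>j. Im (f j))) + total_weight q (Ev (\<lambda>j. - Im (f j))))"
  proof -
    have un: "total_weight q (A \<union> B) \<le> total_weight q A + total_weight q B"
      if "A \<subseteq> Omega M" "B \<subseteq> Omega M" for A B
    proof -
      have fin: "finite A" "finite B" using that finite_Omega finite_subset by blast+
      have "total_weight q (A \<inter> B) \<ge> 0"
        unfolding total_weight_def by (rule sum_nonneg) (use weight_nonneg[of q, OF q_pos] that in blast)
      then show ?thesis using sum.union_inter[OF fin, of "weight q"] by (simp add: total_weight_def)
    qed
    have Ev: "Ev g \<subseteq> Omega M" for g by (auto simp: Ev_def)
    show ?thesis by (rule order_trans[OF un add_mono[OF un un]]; intro Un_least Ev)
  qed
  also have "\<dots> \<le> (exp (entropy M + 32 * t\<^sup>2 * variance_bound (b_sol q M) - t * (D / 2))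
      + exp (entropy M + 32 * t\<^sup>2 * variance_bound (b_sol q M) - t * (D / 2)))
      + (exp (entropy M + 32 * t\<^sup>2 * variance_bound (b_sol q M) - t * (D / 2))
      + exp (entropy M + 32 * t\<^sup>2 * variance_bound (b_sol q M) - t * (D / 2)))"
    unfolding Ev_def using order_trans[OF abs_Re_le_cmod f] order_trans[OF abs_Im_le_cmod f]
    by (intro add_mono chernoff M t) auto
  finally show ?thesis by simp
qed

text \<open>For \<open>d > 2\<close> the variance is at most of order \<open>Nbar\<close>, and
  \<open>t = sqrt (ln Nbar / Nbar)\<close> makes both terms of the exponent comparable to
  \<open>ln Nbar\<close>; it is admissible for large \<open>Nbar\<close> because
  \<open>1 / 2 > 1 / d\<close>. For \<open>d \<le> 2\<close> the largest admissible \<open>t\<close>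
  serves.\<close>

lemma chernoff_parameter:
  obtains K \<kappa> n0 where "\<kappa> > 0" "n0 \<ge> 1"
    "\<And>M. M \<ge> 1 \<Longrightarrow> n0 \<le> Nbar q M \<Longrightarrow> \<exists>t\<ge>0. t \<le> b_sol q M / 2
      \<and> 32 * t\<^sup>2 * variance_bound (b_sol q M) \<le> K * ln (Nbar q M)
      \<and> \<kappa> * ln (Nbar q M) \<le> t * (if d > 2 then sqrt (Nbar q M * ln (Nbar q M))
          else Nbar q M powr (1 / d) * ln (Nbar q M))"
proof -
  obtain n where n: "n > 0" "\<And>M. M \<ge> 1 \<Longrightarrow> n * b_sol q M powr (-d) \<le> Nbar q M"
    by (rule Nbar_lower) blast
  have bN: "(n / Nbar q M) powr (1 / d) \<le> b_sol q M" if M: "M \<ge> 1" and N: "Nbar q M > 0" for M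
  proof -
    have b: "b_sol q M > 0" by (rule b_sol_pos[OF M])
    have "n / Nbar q M \<le> b_sol q M powr d"
      using n(2)[OF M] b N unfolding powr_minus_divide by (simp add: field_simps)
    then have "(n / Nbar q M) powr (1 / d) \<le> (b_sol q M powr d) powr (1 / d)"
      using n N d_gt_1 by (intro powr_mono2) auto
    then show ?thesis using b d_gt_1 by (simp add: powr_powr)
  qed
  show ?thesis
  proof (cases "d > 2")
    case True
    obtain K where K: "K > 0" "\<And>b. b > 0 \<Longrightarrow> variance_bound b \<le> K * b powr (-d)"
      using variance_bound_gt_2[OF True] by blast
    \<comment> \<open>\<open>2 * a = 1 - 2 / d\<close> is the room in \<open>t \<le> b / 2\<close>.
      Half of it pays for the logarithm through \<open>ln N \<le> N powr a / a\<close>, the other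
      half beats the constant \<open>r\<close>.\<close>
    define a where "a = (1 - 2 / d) / 2"
    have a: "a > 0" using True by (simp add: a_def)
    define r where "r = 4 / (a * n powr (2 / d))"
    have r: "r > 0" using a n by (simp add: r_def)
    define n0 where "n0 = max 1 (r powr (1 / a))"
    show ?thesis
    proof (rule that[of 1 n0 "32 * K / n"])
      fix M :: nat assume M: "M \<ge> 1" and N: "n0 \<le> Nbar q M"
      define N where "N = Nbar q M"
      define b where "b = b_sol q M"
      have b: "b > 0" using b_sol_pos[OF M] by (simp add: b_def)
      have N1: "N \<ge> 1" and Nr: "N \<ge> r powr (1 / a)" using N by (auto simp: n0_def N_def)
      have lnN: "ln N \<ge> 0" using N1 by simp
      define t where "t = sqrt (ln N / N)"
      have t2: "t\<^sup>2 = ln N / N" using lnN N1 by (simp add: t_def)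
      have "(r powr (1 / a)) powr a \<le> N powr a" using Nr a by (intro powr_mono2) auto
      then have "r \<le> N powr a" using r a by (simp add: powr_powr)
      then have "4 \<le> N powr a * (a * n powr (2 / d))"
        using a n by (simp add: r_def field_simps)
      then have "N powr a * 4 \<le> N powr a * (N powr a * (a * n powr (2 / d)))"
        by (intro mult_left_mono) auto
      also have "\<dots> = N powr (2 * a) * (a * n powr (2 / d))" by (simp add: powr_add[symmetric])
      finally have "N powr a / a \<le> N powr (2 * a) * n powr (2 / d) / 4" using a by (simp add: field_simps)
      with ln_powr_bound[OF N1 a] have "ln N \<le> N powr (2 * a) * n powr (2 / d) / 4" by linarith
      then have "ln N / N \<le> (N powr (2 * a) * n powr (2 / d) / 4) / N" using N1 by (intro divide_right_mono) auto
      also have "\<dots> = ((n / N) powr (1 / d) / 2)\<^sup>2"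
      proof -
        have "2 * a = 1 + -(2 / d)" by (simp add: a_def)
        then have "N powr (2 * a) = N * N powr (-(2 / d))" using N1 by (simp only: powr_add) simp
        moreover have "((n / N) powr (1 / d))\<^sup>2 = (n / N) powr (2 / d)"
          by (simp add: power2_eq_square powr_add[symmetric])
        moreover have "(n / N) powr (2 / d) = n powr (2 / d) * N powr (-(2 / d))"
          by (simp add: powr_divide powr_minus_divide)
        ultimately show ?thesis using N1 by (simp add: power_divide)
      qed
      also have "\<dots> \<le> (b / 2)\<^sup>2"
        using bN[OF M] N1 by (intro power_mono divide_right_mono) (auto simp: N_def b_def)
      finally have "t \<le> b / 2" unfolding t2[symmetric] by (rule power2_le_imp_le) (use b in simp)
      moreover have "32 * t\<^sup>2 * variance_bound b \<le> 32 * K / n * ln N"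
      proof -
        have "b powr (-d) \<le> N / n" using n(2)[OF M] n(1) by (simp add: N_def b_def field_simps)
        then have "K * b powr (-d) \<le> K * (N / n)" using K by (intro mult_left_mono) auto
        with K(2)[OF b] have "variance_bound b \<le> K * (N / n)" by linarith
        then have "32 * t\<^sup>2 * variance_bound b \<le> 32 * t\<^sup>2 * (K * (N / n))" by (intro mult_left_mono) auto
        also have "\<dots> = 32 * K / n * ln N" using N1 unfolding t2 by simp
        finally show ?thesis .
      qed
      moreover have "1 * ln N \<le> t * sqrt (N * ln N)"
      proof -
        have "t * sqrt (N * ln N) = sqrt ((ln N)\<^sup>2)"
          unfolding t_def real_sqrt_mult[symmetric] using N1 by (simp add: power2_eq_square)
        then show ?thesis using lnN by simp
      qed
      moreover have "t \<ge> 0" using lnN N1 by (simp add: t_def)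
      ultimately show "\<exists>t\<ge>0. t \<le> b_sol q M / 2
        \<and> 32 * t\<^sup>2 * variance_bound (b_sol q M) \<le> 32 * K / n * ln (Nbar q M)
        \<and> 1 * ln (Nbar q M) \<le> t * (if d > 2 then sqrt (Nbar q M * ln (Nbar q M))
          else Nbar q M powr (1 / d) * ln (Nbar q M))"
        using True unfolding N_def b_def by auto
    qed (auto simp: n0_def)
  next
    case False
    obtain B where B: "B > 0" "\<And>M. M \<ge> 1 \<Longrightarrow> b_sol q M \<le> B" by (rule b_sol_bounded) blast
    \<comment> \<open>Collects the constants in the bound for \<open>ln (4 / b) + b / 4\<close>; the
      threshold \<open>exp 1\<close> gives \<open>ln N \<ge> 1\<close>, which lets them be absorbed
      into \<open>k * ln N\<close>.\<close>
    define k where "k = \<bar>ln 4 - ln n / d\<bar> + B / 4"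
    show ?thesis
    proof (rule that[of "n powr (1 / d) / 2" "exp 1" "8 * c2 * (k + 1 / d)"])
      fix M :: nat assume M: "M \<ge> 1" and N: "exp 1 \<le> Nbar q M"
      define N where "N = Nbar q M"
      define b where "b = b_sol q M"
      have b: "b > 0" "b \<le> B" using b_sol_pos[OF M] B(2)[OF M] by (auto simp: b_def)
      have N0: "N > 0" using N exp_gt_zero[of 1] unfolding N_def by linarith
      have lnN: "ln N \<ge> 1" using N N0 by (simp add: N_def ln_ge_iff)
      have bN': "(n / N) powr (1 / d) \<le> b" using bN[OF M] N0 by (simp add: N_def b_def)
      have "ln ((n / N) powr (1 / d)) \<le> ln b" using bN' n N0 b by (intro ln_mono) auto
      then have "(ln n - ln N) / d \<le> ln b" using n N0 by (simp add: ln_powr ln_div)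
      then have "ln (4 / b) + b / 4 \<le> (ln 4 - ln n / d) + B / 4 + ln N / d"
        using b by (simp add: ln_div diff_divide_distrib)
      also have "\<dots> \<le> k * 1 + ln N / d" by (simp add: k_def)
      also have "\<dots> \<le> k * ln N + ln N / d"
        using lnN B by (intro add_right_mono mult_left_mono) (auto simp: k_def)
      also have "\<dots> = (k + 1 / d) * ln N" by (simp add: algebra_simps)
      finally have ln_le: "ln (4 / b) + b / 4 \<le> (k + 1 / d) * ln N" .
      have "32 * (b / 2)\<^sup>2 * variance_bound b = 8 * (b\<^sup>2 * variance_bound b)"
        by (simp add: power_divide)
      also have "\<dots> \<le> 8 * (c2 * (ln (4 / b) + b / 4))"
        using variance_bound_le_2[of b] False b by (intro mult_left_mono) auto
      also have "\<dots> \<le> 8 * (c2 * ((k + 1 / d) * ln N))"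
        using ln_le c2_pos by (intro mult_left_mono) auto
      finally have v: "32 * (b / 2)\<^sup>2 * variance_bound b \<le> 8 * c2 * (k + 1 / d) * ln N" by simp
      have "n powr (1 / d) / 2 * ln N = (n / N) powr (1 / d) / 2 * (N powr (1 / d) * ln N)"
        using N0 by (simp add: powr_divide)
      also have "\<dots> \<le> b / 2 * (N powr (1 / d) * ln N)"
        using bN' lnN by (intro mult_right_mono) auto
      finally have "n powr (1 / d) / 2 * ln N \<le> b / 2 * (N powr (1 / d) * ln N)" .
      with v False b show "\<exists>t\<ge>0. t \<le> b_sol q M / 2
        \<and> 32 * t\<^sup>2 * variance_bound (b_sol q M) \<le> 8 * c2 * (k + 1 / d) * ln (Nbar q M)
        \<and> n powr (1 / d) / 2 * ln (Nbar q M) \<le> t * (if d > 2 then sqrt (Nbar q M * ln (Nbar q M))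
          else Nbar q M powr (1 / d) * ln (Nbar q M))"
        unfolding N_def b_def by (intro exI[of _ "b_sol q M / 2"]) auto
    qed (use n in auto)
  qed
qed

section \<open>From weights to probabilities\<close>

lemma Pr_le_1:
  assumes "A \<subseteq> Omega M"
  shows "Pr q M A \<le> 1"
  using total_weight_mono[of q A "Omega M" M, OF q_pos assms] total_weight_Omega_ge_1[of q M, OF q_pos]
  by (simp add: Pr_def divide_le_eq_1)

lemma large_deviation:
  assumes chi: "filterlim chi at_top at_top"
  obtains C n where "C > 0" "n \<ge> 1"
    "\<And>M f. M \<ge> 1 \<Longrightarrow> (\<And>j. j \<ge> 1 \<Longrightarrow> cmod (f j) \<le> 1) \<Longrightarrow> n \<le> Nbar q M \<Longrightarrow>
      Pr q M {N \<in> Omega M. Delta d q chi M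
        < cmod (\<Sum>\<^sub>\<infinity>j\<in>{1..}. f j * complex_of_real (real (N j) - Nbar_at q M j))}
      \<le> C * Nbar q M powr (- real s)"
proof -
  obtain A c where A: "A \<ge> 0" and c: "c > 0"
    and W: "\<And>M. M \<ge> 1 \<Longrightarrow> c * real M powr (-A) * exp (entropy M) \<le> total_weight q (Omega M)"
    by (rule total_weight_Omega_lower) blast
  obtain K \<kappa> n0 where kap: "\<kappa> > 0" and n0: "n0 \<ge> 1"
    and par: "\<And>M. M \<ge> 1 \<Longrightarrow> n0 \<le> Nbar q M \<Longrightarrow> \<exists>t\<ge>0. t \<le> b_sol q M / 2
      \<and> 32 * t\<^sup>2 * variance_bound (b_sol q M) \<le> K * ln (Nbar q M)
      \<and> \<kappa> * ln (Nbar q M) \<le> t * (if d > 2 then sqrt (Nbar q M * ln (Nbar q M))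
          else Nbar q M powr (1 / d) * ln (Nbar q M))"
    by (rule chernoff_parameter) blast
  obtain n where n: "n > 0" "\<And>M. M \<ge> 1 \<Longrightarrow> n * b_sol q M powr (-d) \<le> Nbar q M"
    by (rule Nbar_lower) blast
  obtain k where k: "k > 0" "\<And>\<beta>. \<beta> > 0 \<Longrightarrow> moment 0 \<beta> \<le> k * \<beta> powr (-(d + 0 + 1))"
    by (rule moment_upper[of 0]) auto
  \<comment> \<open>\<open>M\<close> is at most of order \<open>b powr (-(d + 1))\<close> and
    \<open>Nbar\<close> at least of order \<open>b powr (-d)\<close>; \<open>e\<close> is the ratio
    of the exponents.\<close>
  define e where "e = (d + 1) / d"
  define L where "L = k / n powr e"
  have L: "L > 0" using k n by (simp add: L_def)
  have M_le: "real M \<le> L * Nbar q M powr e" if M: "M \<ge> 1" for M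
  proof -
    have b: "b_sol q M > 0" by (rule b_sol_pos[OF M])
    have "real M \<le> k * b_sol q M powr (-(d + 1))" using k(2)[OF b] moment_b_sol[OF M] by simp
    also have "b_sol q M powr (-(d + 1)) = (b_sol q M powr (-d)) powr e"
      unfolding powr_powr using d_gt_1 by (simp add: e_def)
    also have "\<dots> \<le> (Nbar q M / n) powr e"
      using n(2)[OF M] n(1) d_gt_1 by (intro powr_mono2) (auto simp: e_def field_simps)
    also have "k * (Nbar q M / n) powr e = L * Nbar q M powr e"
      by (simp add: L_def powr_divide)
    finally show ?thesis using k by simp
  qed
  \<comment> \<open>\<open>e * A\<close> pays for the power of \<open>M\<close> lost in the
    denominator, \<open>\<bar>K\<bar>\<close> for the second-order term, and \<open>s\<close> is the
    requested decay; the 2 offsets the halved threshold.\<close>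
  have "\<forall>\<^sub>F x in at_top. 2 * (e * A + \<bar>K\<bar> + real s) / \<kappa> \<le> chi x"
    using chi by (simp add: filterlim_at_top)
  then obtain n1 where n1: "\<And>x. x \<ge> n1 \<Longrightarrow> 2 * (e * A + \<bar>K\<bar> + real s) / \<kappa> \<le> chi x"
    by (auto simp: eventually_at_top_linorder)
  define C where "C = 4 / c * L powr A"
  show ?thesis
  proof (rule that[of C "max n0 n1"])
    fix M :: nat and f :: "nat \<Rightarrow> complex"
    assume M: "M \<ge> 1" and f: "\<And>j. j \<ge> 1 \<Longrightarrow> cmod (f j) \<le> 1" and N: "max n0 n1 \<le> Nbar q M"
    define N where "N = Nbar q M"
    have N1: "N \<ge> 1" "N \<ge> n0" "N \<ge> n1" using N n0 by (auto simp: N_def)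
    then have lnN: "ln N \<ge> 0" by simp
    define D where "D = (if d > 2 then sqrt (N * ln N) else N powr (1 / d) * ln N)"
    \<comment> \<open>\<open>N \<ge> 1\<close> excludes the case in which the square root is read as
      0 by convention.\<close>
    have Delta: "Delta d q chi M = D * chi N"
      using N1 by (simp add: Delta_def D_def N_def)
    obtain t where t: "t \<ge> 0" "t \<le> b_sol q M / 2"
      "32 * t\<^sup>2 * variance_bound (b_sol q M) \<le> K * ln N" "\<kappa> * ln N \<le> t * D"
      using par[OF M] N1 unfolding D_def N_def by blast
    have chiN: "2 * (e * A + \<bar>K\<bar> + real s) / \<kappa> \<le> chi N" using n1 N1 by blast
    have pos: "0 \<le> 2 * (e * A + \<bar>K\<bar> + real s) / \<kappa>" using kap A d_gt_1 by (simp add: e_def)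
    have "(e * A + \<bar>K\<bar> + real s) * ln N = \<kappa> * ln N * (2 * (e * A + \<bar>K\<bar> + real s) / \<kappa>) / 2"
      using kap by simp
    also have "\<dots> \<le> t * D * chi N / 2"
    proof (rule divide_right_mono[OF mult_mono])
      show "0 \<le> t * D" using t(4) kap lnN by (meson mult_nonneg_nonneg less_imp_le order_trans)
    qed (use t(4) chiN pos in auto)
    finally have exponent: "(e * A + \<bar>K\<bar> + real s) * ln N \<le> t * (Delta d q chi M / 2)"
      by (simp add: Delta)
    let ?E = "{N \<in> Omega M. Delta d q chi M
        < cmod (\<Sum>\<^sub>\<infinity>j\<in>{1..}. f j * complex_of_real (real (N j) - Nbar_at q M j))}"
    have KN: "K * ln N \<le> \<bar>K\<bar> * ln N" using lnN by (intro mult_right_mono) auto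
    have "total_weight q ?E \<le> 4 * exp (entropy M + 32 * t\<^sup>2 * variance_bound (b_sol q M) - t * (Delta d q chi M / 2))"
      by (rule chernoff_complex[OF M f t(1,2)])
    also have "\<dots> \<le> 4 * exp (entropy M + - (e * A + real s) * ln N)"
      using t(3) exponent KN by (simp add: algebra_simps)
    also have "\<dots> = 4 * exp (entropy M) * N powr (- (e * A) - real s)"
      using N1 by (simp add: powr_def exp_add[symmetric] algebra_simps)
    finally have upper: "total_weight q ?E \<le> 4 * exp (entropy M) * N powr (- (e * A) - real s)" .
    have M0: "real M powr (-A) > 0" using M by simp
    have "Pr q M ?E \<le> (4 * exp (entropy M) * N powr (- (e * A) - real s)) / (c * real M powr (-A) * exp (entropy M))"
      unfolding Pr_def using upper W[OF M] c M0 by (intro frac_le) auto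
    also have "\<dots> = 4 / c * real M powr A * N powr (- (e * A) - real s)"
      using M c by (simp add: powr_minus_divide)
    also have "\<dots> \<le> 4 / c * (L * N powr e) powr A * N powr (- (e * A) - real s)"
      using M_le[OF M] c A M by (intro mult_right_mono mult_left_mono powr_mono2) (auto simp: N_def)
    also have "\<dots> = C * (N powr (e * A) * N powr (- (e * A) - real s))"
      using L N1 by (simp add: C_def powr_mult powr_powr)
    also have "\<dots> = C * N powr (- real s)"
      by (simp add: powr_add[symmetric])
    finally show "Pr q M ?E \<le> C * Nbar q M powr (- real s)" by (simp add: N_def)
  qed (use c L n0 in \<open>auto simp: C_def\<close>)
qed

text \<open>Where \<open>Nbar\<close> lies below the threshold \<open>n\<close>, the trivial bound 1
  is at most \<open>(n / Nbar) ^ s\<close>; this accounts for the summand \<open>n ^ s\<close> in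
  the constant.\<close>

lemma concentration:
  assumes chi: "filterlim chi at_top at_top"
  shows "\<exists>C>0. \<forall>M\<ge>1. \<forall>f. (\<forall>j\<ge>1. cmod (f j) \<le> 1) \<longrightarrow>
      Pr q M {N \<in> Omega M. Delta d q chi M
        < cmod (\<Sum>\<^sub>\<infinity>j\<in>{1..}. f j * complex_of_real (real (N j) - Nbar_at q M j))}
      \<le> C * Nbar q M powi (- int s)"
proof -
  obtain C n where C: "C > 0" "n \<ge> 1"
    "\<And>M f. M \<ge> 1 \<Longrightarrow> (\<And>j. j \<ge> 1 \<Longrightarrow> cmod (f j) \<le> 1) \<Longrightarrow> n \<le> Nbar q M \<Longrightarrow>
      Pr q M {N \<in> Omega M. Delta d q chi M
        < cmod (\<Sum>\<^sub>\<infinity>j\<in>{1..}. f j * complex_of_real (real (N j) - Nbar_at q M j))}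
      \<le> C * Nbar q M powr (- real s)"
    using large_deviation[OF chi, of s] by blast
  obtain m where m: "m > 0" "\<And>M. M \<ge> 1 \<Longrightarrow> m * b_sol q M powr (-d) \<le> Nbar q M"
    by (rule Nbar_lower) blast
  show ?thesis
  proof (intro exI[of _ "C + n ^ s"] conjI allI impI)
    fix M :: nat and f :: "nat \<Rightarrow> complex"
    assume M: "M \<ge> 1" and f: "\<forall>j\<ge>1. cmod (f j) \<le> 1"
    let ?E = "{N \<in> Omega M. Delta d q chi M
        < cmod (\<Sum>\<^sub>\<infinity>j\<in>{1..}. f j * complex_of_real (real (N j) - Nbar_at q M j))}"
    have "0 < m * b_sol q M powr (-d)" using m b_sol_pos[OF M] by simp
    then have N: "Nbar q M > 0" using m(2)[OF M] by linarith
    have pw: "Nbar q M powr (- real s) = 1 / Nbar q M ^ s"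
      using N by (simp add: powr_minus_divide powr_realpow)
    have "Pr q M ?E \<le> (C + n ^ s) * (1 / Nbar q M ^ s)"
    proof (cases "n \<le> Nbar q M")
      case True
      then have "Pr q M ?E \<le> C * (1 / Nbar q M ^ s)" using C(3)[OF M _ True] f by (simp add: pw)
      also have "\<dots> \<le> (C + n ^ s) * (1 / Nbar q M ^ s)"
        using N C by (intro mult_right_mono) auto
      finally show ?thesis .
    next
      case False
      have "Pr q M ?E \<le> 1" by (rule Pr_le_1) auto
      also have "1 \<le> n ^ s * (1 / Nbar q M ^ s)"
        using False N power_mono[of "Nbar q M" n s] by simp
      also have "\<dots> \<le> (C + n ^ s) * (1 / Nbar q M ^ s)"
        using N C by (intro mult_right_mono) auto
      finally show ?thesis .
    qed
    then show "Pr q M ?E \<le> (C + n ^ s) * Nbar q M powi (- int s)"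
      by (simp add: power_int_minus divide_inverse)
  qed (use C in \<open>auto intro!: add_pos_nonneg\<close>)
qed

end

text \<open>The ratio to the model converges to 1, so it and its inverse are bounded sequences;
  positivity of every \<open>q j\<close> turns this into bounds from \<open>j = 1\<close>
  on.\<close>

lemma asymp_equiv_powr_bounds:
  fixes q :: "nat \<Rightarrow> real"
  assumes Q: "Q > 0" and q: "\<And>j. j \<ge> 1 \<Longrightarrow> q j > 0"
    and lim: "q \<sim>[sequentially] (\<lambda>j. Q * real j powr p)"
  obtains c1 c2 where "c1 > 0" "\<And>j. j \<ge> 1 \<Longrightarrow> c1 * real j powr p \<le> q j"
    "\<And>j. j \<ge> 1 \<Longrightarrow> q j \<le> c2 * real j powr p"
proof -
  define r where "r j = q j / (Q * real j powr p)" for j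
  have r: "r \<longlonglongrightarrow> 1"
    unfolding r_def
    by (rule asymp_equivD_strong[OF lim]) (use Q in \<open>auto intro!: eventually_sequentiallyI[of 1]\<close>)
  have "Bseq r" using r convergentI convergent_imp_Bseq by blast
  then obtain K where K: "K > 0" "\<And>j. \<bar>r j\<bar> \<le> K" by (auto elim!: BseqE)
  have "(\<lambda>j. inverse (r j)) \<longlonglongrightarrow> inverse 1" by (rule tendsto_inverse[OF r]) simp
  then have "Bseq (\<lambda>j. inverse (r j))" using convergentI convergent_imp_Bseq by blast
  then obtain L where L: "L > 0" "\<And>j. \<bar>inverse (r j)\<bar> \<le> L" by (auto elim!: BseqE)
  show ?thesis
  proof (rule that[of "Q / L" "K * Q"])
    fix j :: nat assume j: "j \<ge> 1"
    have x: "Q * real j powr p > 0" using Q j by simp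
    then have rj: "r j > 0" using q[OF j] by (simp add: r_def)
    have "q j \<le> K * (Q * real j powr p)" using K(2)[of j] rj x by (simp add: r_def field_simps)
    then show "q j \<le> K * Q * real j powr p" by (simp add: mult.assoc)
    have "inverse (r j) \<le> L" using L(2)[of j] rj by simp
    then have "Q * real j powr p \<le> L * q j" using q[OF j] by (simp add: r_def field_simps)
    then show "Q / L * real j powr p \<le> q j" using L by (simp add: field_simps)
  qed (use Q L in simp)
qed

theorem theorem2:
  fixes d Q :: real and q :: "nat \<Rightarrow> real" and chi :: "real \<Rightarrow> real"
  assumes "d > 1" and "Q > 0"
    and "\<And>j. j \<ge> 1 \<Longrightarrow> q j > 0"
    and "q \<sim>[sequentially] (\<lambda>j. Q * real j powr (d - 1))"
    and "\<And>x. x \<ge> 0 \<Longrightarrow> chi x > 0"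
    and "filterlim chi at_top at_top"
  shows "\<exists>C :: nat \<Rightarrow> real. (\<forall>s\<ge>1. C s > 0) \<and>
    (\<forall>M::nat. M \<ge> 1 \<longrightarrow> (\<forall>f :: nat \<Rightarrow> complex. (\<forall>j\<ge>1. cmod (f j) \<le> 1) \<longrightarrow>
      (\<forall>s\<ge>1. Pr q M {N \<in> Omega M.
          cmod (\<Sum>\<^sub>\<infinity>j\<in>{1..}. f j * complex_of_real (real (N j) - Nbar_at q M j)) > Delta d q chi M}
        \<le> C s * Nbar q M powi (- int s))))"
proof -
  obtain c1 c2 where "c1 > 0" "\<And>j. j \<ge> 1 \<Longrightarrow> c1 * real j powr (d - 1) \<le> q j"
    "\<And>j. j \<ge> 1 \<Longrightarrow> q j \<le> c2 * real j powr (d - 1)"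
    using asymp_equiv_powr_bounds[OF assms(2,3,4)] by blast
  then interpret boson_gas d c1 c2 q
    using assms(1) by unfold_locales
  have "\<forall>s. \<exists>C>0. \<forall>M\<ge>1. \<forall>f. (\<forall>j\<ge>1. cmod (f j) \<le> 1) \<longrightarrow>
      Pr q M {N \<in> Omega M. Delta d q chi M
        < cmod (\<Sum>\<^sub>\<infinity>j\<in>{1..}. f j * complex_of_real (real (N j) - Nbar_at q M j))}
      \<le> C * Nbar q M powi (- int s)"
    using concentration[OF assms(6)] by blast
  from choice[OF this] show ?thesis by blast
qed

end
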